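(* Let $A\in\mathbb{C}^{n\times n}$ and let $\lambda$ be an eigenvalue of $A$ of algebraic multiplicity $m$ with nonzero Weyr characteristic $m_1\ge\cdots\ge m_k>0$. Set $\mu_0=0$, $\mu_j=m_1+\cdots+m_j$, and $\Phi_\lambda=\{(i,j): \mu_{l-1}<i\le\mu_l,\ i<j\le\mu_l,\ l=1,\dots,k\}$. Then for almost all vectors $\mathbf{b}_1,\dots,\mathbf{b}_m,\mathbf{c}_1,\dots,\mathbf{c}_m\in\mathbb{C}^n$ there is a unique pair of matrices $Y=[\mathbf{y}_1,\dots,\mathbf{y}_m]\in\mathbb{C}^{n\times m}$ and $S\in\mathbb{C}^{m\times m}$, with $S$ a staircase nilpotent matrix with respect to $m_1,\dots,m_k$, such that $$\begin{cases}(A-\lambda I)Y=YS,\\ [\mathbf{c}_1,\dots,\mathbf{c}_i]^{\mathsf H}\mathbf{y}_i=(0,\dots,0,1)^{\top}\in\mathbb{C}^i, & 1\le i\le m,\\ \mathbf{b}_j^{\mathsf H}\mathbf{y}_i=0, & (i,j)\in\Phi_\lambda.\end{cases}$$ Moreover, the Jacobian of the map $\mathbf{f}$ defined below is of full column rank at $(\lambda,Y,S)$.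
   Context: The Weyr characteristic of $A$ at $\lambda$ is $m_j=\dim\ker(A-\lambda I)^j-\dim\ker(A-\lambda I)^{j-1}$, $j\ge1$; its nonzero part $m_1\ge\cdots\ge m_k$ sums to $m$. A staircase nilpotent matrix with respect to $m_1,\dots,m_k$ is an $S\in\mathbb{C}^{m\times m}$ which, partitioned into blocks $S_{ij}\in\mathbb{C}^{m_i\times m_j}$, has $S_{ij}=O$ for $i\ge j$; let $\mathcal{S}$ denote the space of such matrices, whose free entries are those of the blocks $S_{ij}$ with $i<j$ (so $\mathcal S\cong\mathbb{C}^{\sum_{i<j}m_im_j}$). With $\mathbf b_j,\mathbf c_j$ fixed, define $\mathbf{f}:\mathbb{C}\times\mathbb{C}^{n\times m}\times\mathcal S\to\mathbb{C}^{\eta}$, $\eta=nm+\tfrac{m(m+1)}{2}+|\Phi_\lambda|$, by $\mathbf f(\lambda,Y,S)$ = the vector whose components are the entries of the columns $((A-\lambda I)Y-YS)\mathbf e_1,\dots,((A-\lambda I)Y-YS)\mathbf e_m$, followed by the numbers $\mathbf c_j^{\mathsf H}\mathbf y_i-\delta_{ij}$ for $1\le j\le i\le m$, followed by the numbers $\mathbf b_j^{\mathsf H}\mathbf y_i$ for $(i,j)\in\Phi_\lambda$ ($\delta_{ij}$ the Kronecker delta). The Jacobian is the complex $\eta\times\zeta$ matrix of partial derivatives of $\mathbf f$ with respect to the $\zeta=1+nm+\sum_{i<j}m_im_j$ variables $\lambda$, the entries of $Y$, and the free entries of $S$ ($\mathbf f$ is holomorphic in these variables). "For almost all" means outside a set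 of Lebesgue measure zero. *)

theory Defs
  imports "HOL-Analysis.Analysis"
    "Jordan_Normal_Form.Jordan_Normal_Form_Uniqueness"
    "Jordan_Normal_Form.DL_Rank"
begin

definition weyr :: "complex mat \<Rightarrow> complex \<Rightarrow> nat \<Rightarrow> nat" where
  "weyr A lam j = dim_gen_eigenspace A lam j - dim_gen_eigenspace A lam (j - 1)"

text \<open>0-based block index of row/column i w.r.t. block sizes ms = [m_1,...,m_k]:
  the number of l in 1..k with mu_l <= i (so i lies in block blk+1, 1-based).\<close>
definition blk :: "nat list \<Rightarrow> nat \<Rightarrow> nat" where
  "blk ms i = card {l. 1 \<le> l \<and> l \<le> length ms \<and> sum_list (take l ms) \<le> i}"

definition staircase :: "nat list \<Rightarrow> complex mat \<Rightarrow> bool" where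
  "staircase ms S \<longleftrightarrow> S \<in> carrier_mat (sum_list ms) (sum_list ms) \<and>
     (\<forall>i < sum_list ms. \<forall>j < sum_list ms. blk ms j \<le> blk ms i \<longrightarrow> S $$ (i, j) = 0)"

definition Phi_list :: "nat list \<Rightarrow> (nat \<times> nat) list" where
  "Phi_list ms = [(i, j). i \<leftarrow> [0..<sum_list ms], j \<leftarrow> [0..<sum_list ms], i < j \<and> blk ms i = blk ms j]"

definition Phi :: "nat list \<Rightarrow> (nat \<times> nat) set" where
  "Phi ms = set (Phi_list ms)"

definition herm :: "complex vec \<Rightarrow> complex vec \<Rightarrow> complex" where
  "herm x y = (\<Sum>k < dim_vec x. cnj (x $ k) * y $ k)"

definition is_sol :: "complex mat \<Rightarrow> complex \<Rightarrow> nat \<Rightarrow> nat \<Rightarrow> nat list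
    \<Rightarrow> (nat \<Rightarrow> complex vec) \<Rightarrow> (nat \<Rightarrow> complex vec) \<Rightarrow> complex mat \<times> complex mat \<Rightarrow> bool" where
  "is_sol A lam n m ms b c YS \<longleftrightarrow>
     (let Y = fst YS; S = snd YS in
       Y \<in> carrier_mat n m \<and> staircase ms S \<and>
       (A - lam \<cdot>\<^sub>m 1\<^sub>m n) * Y = Y * S \<and>
       (\<forall>i < m. \<forall>j \<le> i. herm (c j) (col Y i) = (if j = i then 1 else 0)) \<and>
       (\<forall>(i, j) \<in> Phi ms. herm (b j) (col Y i) = 0))"

text \<open>Variables of f: lambda, the entries of Y, the free entries of S.\<close>
datatype var = VLam | VY nat nat | VS nat nat

definition vars :: "nat \<Rightarrow> nat list \<Rightarrow> var list" where
  "vars n ms = VLam # [VY i j. j \<leftarrow> [0..<sum_list ms], i \<leftarrow> [0..<n]]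
      @ [VS i j. i \<leftarrow> [0..<sum_list ms], j \<leftarrow> [0..<sum_list ms], blk ms i < blk ms j]"

definition mat_upd :: "complex mat \<Rightarrow> nat \<Rightarrow> nat \<Rightarrow> complex \<Rightarrow> complex mat" where
  "mat_upd M i j t = mat (dim_row M) (dim_col M) (\<lambda>(a, b). if (a, b) = (i, j) then t else M $$ (a, b))"

fun var_upd :: "complex \<times> complex mat \<times> complex mat \<Rightarrow> var \<Rightarrow> complex \<Rightarrow> complex \<times> complex mat \<times> complex mat" where
  "var_upd (l, Y, S) VLam t = (t, Y, S)"
| "var_upd (l, Y, S) (VY i j) t = (l, mat_upd Y i j t, S)"
| "var_upd (l, Y, S) (VS i j) t = (l, Y, mat_upd S i j t)"

fun var_val :: "complex \<times> complex mat \<times> complex mat \<Rightarrow> var \<Rightarrow> complex" where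
  "var_val (l, Y, S) VLam = l"
| "var_val (l, Y, S) (VY i j) = Y $$ (i, j)"
| "var_val (l, Y, S) (VS i j) = S $$ (i, j)"

definition fmap :: "complex mat \<Rightarrow> nat \<Rightarrow> nat list \<Rightarrow> (nat \<Rightarrow> complex vec) \<Rightarrow> (nat \<Rightarrow> complex vec)
    \<Rightarrow> complex \<times> complex mat \<times> complex mat \<Rightarrow> complex list" where
  "fmap A n ms b c p = (case p of (l, Y, S) \<Rightarrow>
     (let R = (A - l \<cdot>\<^sub>m 1\<^sub>m n) * Y - Y * S; m = sum_list ms in
       [R $$ (i, j). j \<leftarrow> [0..<m], i \<leftarrow> [0..<n]]
       @ [herm (c j) (col Y i) - (if i = j then 1 else 0). i \<leftarrow> [0..<m], j \<leftarrow> [0..<Suc i]]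
       @ [herm (b j) (col Y i). (i, j) \<leftarrow> Phi_list ms]))"

definition jacobian :: "(complex \<times> complex mat \<times> complex mat \<Rightarrow> complex list)
    \<Rightarrow> complex \<times> complex mat \<times> complex mat \<Rightarrow> var list \<Rightarrow> complex mat" where
  "jacobian f p vs = mat (length (f p)) (length vs)
     (\<lambda>(r, k). deriv (\<lambda>t. f (var_upd p (vs ! k) t) ! r) (var_val p (vs ! k)))"

definition full_col_rank :: "complex mat \<Rightarrow> bool" where
  "full_col_rank J \<longleftrightarrow> vec_space.rank (dim_row J) J = dim_col J"

end

theory Submission
  imports Defs "Jordan_Normal_Form.Jordan_Normal_Form_Existence"
begin

unbundle no vec_syntax

text \<open>
  Put \<open>N = A - \<lambda> I\<close> and \<open>K\<^sub>l = ker N\<^sup>l\<close>, so that \<open>dim K\<^sub>l = \<mu>\<^sub>l\<close>. The staircase shape of \<open>S\<close> forces a column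
  \<open>y\<^sub>i\<close> in block \<open>l\<close> to lie in \<open>K\<^sub>l\<close>, where it is subject to exactly \<open>\<mu>\<^sub>l\<close> linear conditions given by
  \<open>c\<^sub>1,\<dots>,c\<^sub>i,b\<^sub>i\<^sub>+\<^sub>1,\<dots>\<close>. Their matrix in a basis of \<open>K\<^sub>l\<close> has a determinant that is affine in the conjugate of
  each single entry of the vectors \<open>b, c\<close> and is a Gram determinant for a suitable choice, so by Fubini it
  vanishes only on a null set. This yields \<open>Y\<close>; the conditions on \<open>c\<close> are triangular, so the first \<open>\<mu>\<^sub>l\<close>
  columns form a basis of \<open>K\<^sub>l\<close>, and \<open>N y\<^sub>i \<in> K\<^sub>l\<^sub>-\<^sub>1\<close> determines the columns of \<open>S\<close>.

  A kernel vector \<open>(\<sigma>, Z, T)\<close> of the Jacobian satisfies \<open>N Z - Z S = Y (\<sigma> I + T)\<close>. Hence \<open>Z = Y P\<close> and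
  \<open>S P - P S = \<sigma> I + T\<close>, whose trace gives \<open>\<sigma> = 0\<close>; then \<open>z\<^sub>i \<in> K\<^sub>l\<close> satisfies the homogeneous conditions,
  so \<open>Z = 0\<close> and \<open>T = 0\<close>.
\<close>

section \<open>Generic determinants\<close>

text \<open>Induction on the coordinates with Fubini. With coordinate \<open>i\<close> frozen at
  \<open>z0 i\<close>, \<open>g\<close> is nonzero for almost all values of the others; there the
  section in \<open>i\<close> is not identically zero, so its zeros are countable and hence
  null.\<close>

lemma AE_PiM_lborel_nonzero:
  fixes g :: "('i \<Rightarrow> complex) \<Rightarrow> complex"
  assumes "finite I"
    and "g \<in> borel_measurable (PiM I (\<lambda>_. lborel))"
    and "\<And>i z. i \<in> I \<Longrightarrow> (\<forall>t. g (z(i := t)) = 0) \<or> countable {t. g (z(i := t)) = 0}"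
    and "z0 \<in> extensional I" "g z0 \<noteq> 0"
  shows "AE z in PiM I (\<lambda>_. lborel). g z \<noteq> 0"
  using assms
proof (induction I arbitrary: g z0 rule: finite_induct)
  case empty
  then show ?case by (auto simp: PiM_empty)
next
  case (insert i I)
  interpret product_sigma_finite "\<lambda>_::'i. lborel :: complex measure"
    by (intro product_sigma_finite.intro lborel.sigma_finite_measure_axioms)
  let ?M = "\<lambda>_::'i. lborel :: complex measure"
  note [measurable] = insert.prems(1)
  let ?G = "{z \<in> space (PiM (insert i I) ?M). g z = 0}"
  have G: "?G \<in> sets (PiM (insert i I) ?M)" by measurable
  have meas': "(\<lambda>z. g (z(i := z0 i))) \<in> borel_measurable (PiM I ?M)"
  proof -
    have "(\<lambda>z. z(i := z0 i)) \<in> measurable (PiM I ?M) (PiM (insert i I) ?M)"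
      by (rule measurable_fun_upd[where J = I]) auto
    from measurable_compose[OF this insert.prems(1)] show ?thesis .
  qed
  have "AE z in PiM I ?M. g (z(i := z0 i)) \<noteq> 0"
  proof (rule insert.IH[where ?z0.0 = "restrict z0 I", OF meas'])
    fix j z assume j: "j \<in> I"
    then have "j \<noteq> i" using insert.hyps by auto
    then show "(\<forall>t. g ((z(j := t))(i := z0 i)) = 0) \<or> countable {t. g ((z(j := t))(i := z0 i)) = 0}"
      using insert.prems(2)[of j "z(i := z0 i)"] j
      by (simp add: fun_upd_twist[of j i] del: fun_upd_apply)
  next
    \<comment> \<open>Extensionality of \<open>z0\<close> makes the two functions agree outside
      \<open>insert i I\<close> as well.\<close>
    have "(restrict z0 I)(i := z0 i) = z0"
      using insert.prems(3) insert.hyps by (auto simp: extensional_def fun_eq_iff restrict_def)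
    then show "g ((restrict z0 I)(i := z0 i)) \<noteq> 0" using insert.prems(4) by simp
  qed (rule restrict_extensional)
  then have inner: "AE z in PiM I ?M. (\<integral>\<^sup>+ t. indicator ?G (z(i := t)) \<partial>lborel) = 0"
  proof (rule AE_mp, intro AE_I2 impI)
    fix z assume z: "z \<in> space (PiM I ?M)" and nz: "g (z(i := z0 i)) \<noteq> 0"
    have "countable {t. g (z(i := t)) = 0}"
      using insert.prems(2)[of i z] nz by blast
    then have "AE t in lborel. t \<notin> {t. g (z(i := t)) = 0}"
      by (intro AE_not_in countable_imp_null_set_lborel)
    then have "AE t in lborel. (indicator ?G (z(i := t)) :: ennreal) = 0"
      by (rule AE_mp) (simp add: indicator_def)
    then have "(\<integral>\<^sup>+ t. indicator ?G (z(i := t)) \<partial>lborel) = (\<integral>\<^sup>+ t. 0 \<partial>(lborel :: complex measure))"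
      by (rule nn_integral_cong_AE)
    then show "(\<integral>\<^sup>+ t. indicator ?G (z(i := t)) \<partial>lborel) = 0" by simp
  qed
  have "emeasure (PiM (insert i I) ?M) ?G = (\<integral>\<^sup>+ z. indicator ?G z \<partial>PiM (insert i I) ?M)"
    using G by simp
  also have "\<dots> = (\<integral>\<^sup>+ z. (\<integral>\<^sup>+ t. indicator ?G (z(i := t)) \<partial>lborel) \<partial>PiM I ?M)"
    using G by (intro product_nn_integral_insert insert.hyps) simp
  also have "\<dots> = (\<integral>\<^sup>+ z. 0 \<partial>PiM I ?M)"
    by (rule nn_integral_cong_AE) (use inner in simp)
  finally have "emeasure (PiM (insert i I) ?M) ?G = 0" by simp
  with G show ?case by (intro AE_I[of _ _ ?G]) auto
qed

lemma countable_affine_cnj_zeros: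
  fixes a b :: complex
  shows "(\<forall>t. a + cnj t * b = 0) \<or> countable {t. a + cnj t * b = 0}"
proof (cases "b = 0")
  case False
  have "t = cnj (- a / b)" if "a + cnj t * b = 0" for t
  proof -
    have "cnj t * b = - a" using that by (simp add: eq_neg_iff_add_eq_0 add.commute)
    then have "cnj t = - a / b" using False nonzero_eq_divide_eq by blast
    then show ?thesis by (metis complex_cnj_cnj)
  qed
  then have "{t. a + cnj t * b = 0} \<subseteq> {cnj (- a / b)}" by blast
  then show ?thesis by (auto intro: countable_subset)
qed auto

text \<open>Laplace expansion along row \<open>r\<close>: the cofactors avoid that row, so they do
  not depend on \<open>t\<close>.\<close>

lemma det_affine_cnj_row:
  fixes F :: "complex \<Rightarrow> complex mat"
  assumes F: "\<And>t. F t \<in> carrier_mat d d" and r: "r < d"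
    and row: "\<And>t s. s < d \<Longrightarrow> F t $$ (r, s) = p s + cnj t * q s"
    and other: "\<And>t r' s. r' < d \<Longrightarrow> s < d \<Longrightarrow> r' \<noteq> r \<Longrightarrow> F t $$ (r', s) = F 0 $$ (r', s)"
  shows "\<exists>a b. \<forall>t. det (F t) = a + cnj t * b"
proof -
  have cof: "cofactor (F t) r s = cofactor (F 0) r s" if "s < d" for t s
  proof -
    have "mat_delete (F t) r s = mat_delete (F 0) r s"
      using F[of t] F[of 0] that r unfolding mat_delete_def
      by (intro eq_matI) (auto intro!: other)
    then show ?thesis by (simp add: cofactor_def)
  qed
  have "det (F t) = (\<Sum>s<d. p s * cofactor (F 0) r s) + cnj t * (\<Sum>s<d. q s * cofactor (F 0) r s)" for t
  proof -
    have "det (F t) = (\<Sum>s<d. (p s + cnj t * q s) * cofactor (F 0) r s)"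
      unfolding laplace_expansion_row[OF F r] by (intro sum.cong refl) (metis cof lessThan_iff row)
    then show ?thesis by (simp add: algebra_simps sum.distrib sum_distrib_left)
  qed
  then show ?thesis by blast
qed

text \<open>If the Gram matrix G kills \<open>a\<close>, then 0 = a^H G a = ||B a||^2, so
  \<open>B\<close> kills \<open>a\<close> and injectivity gives \<open>a = 0\<close>.\<close>

lemma gram_det_nonzero:
  fixes B :: "complex mat"
  assumes B: "B \<in> carrier_mat n d"
    and inj: "\<And>a. a \<in> carrier_vec d \<Longrightarrow> B *\<^sub>v a = 0\<^sub>v n \<Longrightarrow> a = 0\<^sub>v d"
  shows "det (mat d d (\<lambda>(r, s). herm (col B r) (col B s))) \<noteq> 0"
proof
  let ?G = "mat d d (\<lambda>(r, s). herm (col B r) (col B s))"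
  assume "det ?G = 0"
  then obtain a where a: "a \<in> carrier_vec d" "a \<noteq> 0\<^sub>v d" "?G *\<^sub>v a = 0\<^sub>v d"
    using det_0_iff_vec_prod_zero_field[of ?G d] by auto
  let ?w = "B *\<^sub>v a"
  have w: "?w $ k = (\<Sum>s<d. B $$ (k, s) * a $ s)" if "k < n" for k
    using that B a by (simp add: scalar_prod_def atLeast0LessThan)
  have row: "(\<Sum>s<d. herm (col B r) (col B s) * a $ s) = 0" if "r < d" for r
  proof -
    have "(?G *\<^sub>v a) $ r = (\<Sum>s<d. herm (col B r) (col B s) * a $ s)"
      using that a(1) by (simp add: scalar_prod_def atLeast0LessThan)
    moreover have "(?G *\<^sub>v a) $ r = 0" unfolding a(3) using that by simp
    ultimately show ?thesis by (rule trans[OF sym])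
  qed
  have "(\<Sum>k<n. cnj (?w $ k) * ?w $ k)
      = (\<Sum>k<n. \<Sum>r<d. \<Sum>s<d. cnj (a $ r) * (cnj (B $$ (k, r)) * B $$ (k, s) * a $ s))"
    by (intro sum.cong refl) (simp only: lessThan_iff w cnj_sum sum_product, simp add: mult_ac)
  also have "\<dots> = (\<Sum>r<d. \<Sum>k<n. \<Sum>s<d. cnj (a $ r) * (cnj (B $$ (k, r)) * B $$ (k, s) * a $ s))"
    by (rule sum.swap)
  also have "\<dots> = (\<Sum>r<d. \<Sum>s<d. \<Sum>k<n. cnj (a $ r) * (cnj (B $$ (k, r)) * B $$ (k, s) * a $ s))"
    by (intro sum.cong[OF refl] sum.swap)
  also have "\<dots> = (\<Sum>r<d. cnj (a $ r) * (\<Sum>s<d. herm (col B r) (col B s) * a $ s))"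
    using B by (simp add: herm_def sum_distrib_left sum_distrib_right)
  also have "\<dots> = 0" by (simp add: row)
  finally have "complex_of_real (\<Sum>k<n. (cmod (?w $ k))\<^sup>2) = 0"
    by (simp add: complex_norm_square mult.commute del: of_real_power)
  then have "(\<Sum>k<n. (cmod (?w $ k))\<^sup>2) = 0"
    using of_real_eq_0_iff by blast
  then have "?w $ k = 0" if "k < n" for k
    using that by (subst (asm) sum_nonneg_eq_0_iff) auto
  then have "?w = 0\<^sub>v n" using B by (intro eq_vecI) auto
  with inj a show False by auto
qed

text \<open>\<open>\<rho>\<close> tells which of the vectors stored in \<open>z\<close> supplies row
  \<open>r\<close>. As it is injective, a coordinate of \<open>z\<close> enters at most one row, so
  the determinant is affine in its conjugate, and the rows can be prescribed independently so as to
  produce a Gram matrix.\<close>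

lemma AE_det_herm_nonzero:
  fixes B :: "complex mat" and \<rho> :: "nat \<Rightarrow> nat"
  assumes B: "B \<in> carrier_mat n d"
    and inj: "\<And>a. a \<in> carrier_vec d \<Longrightarrow> B *\<^sub>v a = 0\<^sub>v n \<Longrightarrow> a = 0\<^sub>v d"
    and \<rho>: "inj_on \<rho> {..<d}" "\<rho> ` {..<d} \<subseteq> J" and J: "finite J"
  shows "AE z in PiM (J \<times> {..<n}) (\<lambda>_. lborel :: complex measure).
    det (mat d d (\<lambda>(r, s). herm (vec n (\<lambda>k. z (\<rho> r, k))) (col B s))) \<noteq> 0"
proof -
  let ?F = "\<lambda>z. mat d d (\<lambda>(r, s). herm (vec n (\<lambda>k. z (\<rho> r, k))) (col B s))"
  let ?M = "PiM (J \<times> {..<n}) (\<lambda>_. lborel :: complex measure)"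
  have meas: "(\<lambda>z. det (?F z)) \<in> borel_measurable ?M"
  proof -
    \<comment> \<open>The Leibniz formula is a polynomial in the conjugated coordinates, which makes
      measurability evident.\<close>
    have "(\<lambda>z. \<Sum>p | p permutes {0..<d}. signof p * (\<Prod>i = 0..<d. \<Sum>k<n. cnj (z (\<rho> i, k)) * B $$ (k, p i)))
        \<in> borel_measurable ?M"
    proof (intro borel_measurable_sum borel_measurable_times borel_measurable_prod borel_measurable_const)
      fix p i k assume "i \<in> {0..<d}" "k \<in> {..<n}"
      then have "(\<rho> i, k) \<in> J \<times> {..<n}" using \<rho> by auto
      then have "(\<lambda>z. z (\<rho> i, k)) \<in> borel_measurable ?M"
        using measurable_component_singleton[of "(\<rho> i, k)" "J \<times> {..<n}" "\<lambda>_. lborel :: complex measure"] by simp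
      moreover have "cnj \<in> borel_measurable borel"
        by (intro borel_measurable_continuous_onI continuous_intros)
      ultimately show "(\<lambda>z. cnj (z (\<rho> i, k))) \<in> borel_measurable ?M"
        by (rule measurable_compose)
    qed
    also have "(\<lambda>z. \<Sum>p | p permutes {0..<d}. signof p * (\<Prod>i = 0..<d. \<Sum>k<n. cnj (z (\<rho> i, k)) * B $$ (k, p i)))
      = (\<lambda>z. det (?F z))"
    proof
      fix z
      show "(\<Sum>p | p permutes {0..<d}. signof p * (\<Prod>i = 0..<d. \<Sum>k<n. cnj (z (\<rho> i, k)) * B $$ (k, p i))) = det (?F z)"
        unfolding det_def'[OF mat_carrier]
      proof (intro sum.cong prod.cong arg_cong2[where f = times] refl)
        fix p i assume "p \<in> {p. p permutes {0..<d}}" "i \<in> {0..<d}"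
        then have "p i \<in> {0..<d}" "i < d" by (auto simp: permutes_in_image)
        then show "(\<Sum>k<n. cnj (z (\<rho> i, k)) * B $$ (k, p i)) = ?F z $$ (i, p i)"
          using B by (simp add: herm_def)
      qed
    qed
    finally show ?thesis .
  qed
  show ?thesis
  proof (rule AE_PiM_lborel_nonzero[OF _ meas])
    \<comment> \<open>The witness stores column \<open>r\<close> of \<open>B\<close> as vector
      number \<open>\<rho> r\<close> and zero vectors elsewhere, so the matrix becomes the Gram
      matrix of the columns.\<close>
    define z0 where "z0 = restrict (\<lambda>(j, k). if j \<in> \<rho> ` {..<d} then col B (the_inv_into {..<d} \<rho> j) $ k else 0) (J \<times> {..<n})"
    show "z0 \<in> extensional (J \<times> {..<n})" by (simp add: z0_def)
    have "vec n (\<lambda>k. z0 (\<rho> r, k)) = col B r" if "r < d" for r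
      using that \<rho> B by (intro eq_vecI) (auto simp: z0_def the_inv_into_f_f image_subset_iff)
    then have "?F z0 = mat d d (\<lambda>(r, s). herm (col B r) (col B s))"
      by (intro eq_matI) auto
    then show "det (?F z0) \<noteq> 0" using gram_det_nonzero[OF B inj] by simp
  next
    fix i and z :: "nat \<times> nat \<Rightarrow> complex" assume i: "i \<in> J \<times> {..<n}"
    obtain j k where jk: "i = (j, k)" "j \<in> J" "k < n" using i by auto
    let ?Ft = "\<lambda>t. ?F (z(i := t))"
    have "\<exists>a b. \<forall>t. det (?Ft t) = a + cnj t * b"
    proof (cases "j \<in> \<rho> ` {..<d}")
      case True
      then obtain r where r: "r < d" "j = \<rho> r" by auto
      show ?thesis
      proof (rule det_affine_cnj_row[where F = ?Ft, OF _ r(1)])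
        fix t s assume s: "s < d"
        have "?Ft t $$ (r, s) = (\<Sum>l<n. cnj ((z(i := t)) (\<rho> r, l)) * B $$ (l, s))"
          using r s B by (simp add: herm_def)
        also have "\<dots> = (\<Sum>l\<in>{..<n} - {k}. cnj (z (\<rho> r, l)) * B $$ (l, s)) + cnj t * B $$ (k, s)"
          using jk r by (subst sum.remove[of _ k]) (auto intro!: sum.cong)
        finally show "?Ft t $$ (r, s) = (\<Sum>l\<in>{..<n} - {k}. cnj (z (\<rho> r, l)) * B $$ (l, s)) + cnj t * B $$ (k, s)" .
      next
        fix t r' s assume "r' < d" "s < d" "r' \<noteq> r"
        then show "?Ft t $$ (r', s) = ?Ft 0 $$ (r', s)"
          using \<rho>(1) r jk by (auto simp: herm_def inj_on_def intro!: sum.cong)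
      qed simp
    next
      case False
      \<comment> \<open>Vector \<open>j\<close> supplies no row, so the affine function has slope
        0.\<close>
      then have "?Ft t = ?F z" for t
        using jk by (intro eq_matI) (auto simp: herm_def intro!: sum.cong)
      then have "\<forall>t. det (?Ft t) = det (?F z) + cnj t * 0" by simp
      then show ?thesis by blast
    qed
    then obtain a b where "\<And>t. det (?Ft t) = a + cnj t * b" by blast
    then show "(\<forall>t. det (?Ft t) = 0) \<or> countable {t. det (?Ft t) = 0}"
      using countable_affine_cnj_zeros[of a b] by simp
  qed (use J in auto)
qed

section \<open>Kernels and block indices\<close>

lemma mult_mat_vec_zero: "A \<in> carrier_mat n d \<Longrightarrow> A *\<^sub>v 0\<^sub>v d = 0\<^sub>v n"
  by (intro eq_vecI) (auto simp: scalar_prod_def)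

lemma inj_square_mat_surj:
  fixes P :: "'a :: field mat"
  assumes P: "P \<in> carrier_mat d d"
    and inj: "\<And>a. a \<in> carrier_vec d \<Longrightarrow> P *\<^sub>v a = 0\<^sub>v d \<Longrightarrow> a = 0\<^sub>v d"
    and v: "v \<in> carrier_vec d"
  shows "\<exists>a \<in> carrier_vec d. P *\<^sub>v a = v"
proof -
  have "det P \<noteq> 0" using det_0_iff_vec_prod_zero_field[OF P] inj by auto
  from det_non_zero_imp_unit[OF P this, unfolded Units_def, of "()"]
  obtain Q where Q: "Q \<in> carrier_mat d d" "P * Q = 1\<^sub>m d"
    by (auto simp: ring_mat_def)
  have "P *\<^sub>v (Q *\<^sub>v v) = (P * Q) *\<^sub>v v"
    by (rule assoc_mult_mat_vec[symmetric, OF P Q(1) v])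
  then have "P *\<^sub>v (Q *\<^sub>v v) = v" using Q v by simp
  then show ?thesis using Q v by (intro bexI[of _ "Q *\<^sub>v v"]) auto
qed

text \<open>Writing \<open>Y = B * P\<close>, injectivity of \<open>Y\<close> passes to the square
  matrix \<open>P\<close>, which is therefore surjective. This is the matrix form of the fact that a
  subspace of full dimension is the whole space.\<close>

lemma range_mat_eq_of_subset:
  fixes B Y :: "'a :: field mat"
  assumes B: "B \<in> carrier_mat n d" and Y: "Y \<in> carrier_mat n d"
    and inj: "\<And>a. a \<in> carrier_vec d \<Longrightarrow> Y *\<^sub>v a = 0\<^sub>v n \<Longrightarrow> a = 0\<^sub>v d"
    and sub: "\<And>j. j < d \<Longrightarrow> \<exists>a \<in> carrier_vec d. col Y j = B *\<^sub>v a"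
    and a: "a \<in> carrier_vec d"
  shows "\<exists>a' \<in> carrier_vec d. Y *\<^sub>v a' = B *\<^sub>v a"
proof -
  from sub obtain p where p: "\<And>j. j < d \<Longrightarrow> p j \<in> carrier_vec d" "\<And>j. j < d \<Longrightarrow> col Y j = B *\<^sub>v p j"
    by metis
  define P where "P = mat d d (\<lambda>(i, j). p j $ i)"
  have P: "P \<in> carrier_mat d d" by (simp add: P_def)
  have colP: "col P j = p j" if "j < d" for j
    using that p(1)[OF that] by (intro eq_vecI) (auto simp: P_def)
  have YP: "Y = B * P"
    by (rule mat_col_eqI) (use B P Y p colP in \<open>auto simp: col_mult2[OF B P]\<close>)
  have "x = 0\<^sub>v d" if x: "x \<in> carrier_vec d" "P *\<^sub>v x = 0\<^sub>v d" for x
  proof (rule inj[OF x(1)])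
    have "Y *\<^sub>v x = B *\<^sub>v (P *\<^sub>v x)" unfolding YP by (rule assoc_mult_mat_vec[OF B P x(1)])
    then show "Y *\<^sub>v x = 0\<^sub>v n" using x B by (simp add: mult_mat_vec_zero)
  qed
  from inj_square_mat_surj[OF P this a] obtain a' where a': "a' \<in> carrier_vec d" "P *\<^sub>v a' = a" by auto
  have "Y *\<^sub>v a' = B *\<^sub>v (P *\<^sub>v a')" unfolding YP by (rule assoc_mult_mat_vec[OF B P a'(1)])
  then show ?thesis using a' by auto
qed

text \<open>Row reduction preserves the kernel, and the base vectors read off the echelon form
  become the columns of \<open>B\<close>. The three clauses say that the columns lie in the kernel,
  span it and are independent.\<close>

lemma kernel_basis_mat:
  fixes M :: "'a :: field mat"
  assumes M: "M \<in> carrier_mat n n" and d: "d = kernel_dim M"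
  shows "\<exists>B \<in> carrier_mat n d. (\<forall>a \<in> carrier_vec d. M *\<^sub>v (B *\<^sub>v a) = 0\<^sub>v n) \<and>
    (\<forall>v \<in> carrier_vec n. M *\<^sub>v v = 0\<^sub>v n \<longrightarrow> (\<exists>a \<in> carrier_vec d. v = B *\<^sub>v a)) \<and>
    (\<forall>a \<in> carrier_vec d. B *\<^sub>v a = 0\<^sub>v n \<longrightarrow> a = 0\<^sub>v d)"
proof -
  let ?C = "gauss_jordan_single M"
  from gauss_jordan_single[OF M refl] obtain P Q where C: "?C = P * M" "Q * P = 1\<^sub>m n"
    "P \<in> carrier_mat n n" "Q \<in> carrier_mat n n" "?C \<in> carrier_mat n n" "row_echelon_form ?C" by auto
  interpret K: kernel n n ?C by (unfold_locales, rule C)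
  have ker: "mat_kernel ?C = mat_kernel M"
    using mat_kernel_mult_eq[OF M C(3,4,2)] C(1) by simp
  define S where "S = set (find_base_vectors ?C)"
  note S = find_base_vectors[OF C(6,5), folded S_def]
  have finS: "finite S" by (simp add: S_def)
  have "kernel_dim M = card S"
    unfolding kernel_dim_def using M ker S(4,6) by simp
  then have card: "card S = d" using d by simp
  from finite_distinct_list[OF finS] obtain xs where xs: "set xs = S" "distinct xs" by auto
  have len: "length xs = d" using xs card distinct_card by fastforce
  have Ssub: "S \<subseteq> carrier_vec n" using S(1) mat_kernel[OF C(5)] by auto
  define B where "B = mat_of_cols n xs"
  have B: "B \<in> carrier_mat n d" using len by (auto simp: B_def)
  have cols: "cols B = xs" unfolding B_def using Ssub xs by (intro cols_mat_of_cols) auto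
  have basis: "\<not> K.NC.lin_dep S" "K.NC.span S = mat_kernel M"
    using S(3) K.lindep_same[OF S(1)] K.span_same[OF S(1)] ker unfolding K.Ker.basis_def by auto
  show ?thesis
  proof (intro bexI[OF _ B] conjI ballI impI)
    have MB: "M * B = 0\<^sub>m n d"
    proof (rule mat_col_eqI)
      fix j assume "j < dim_col (0\<^sub>m n d :: 'a mat)"
      then have j: "j < d" by simp
      then have "col B j \<in> S" using cols xs len B by (metis carrier_matD(2) cols_nth nth_mem)
      then have "M *\<^sub>v col B j = 0\<^sub>v n" using S(1) ker mat_kernelD[OF M] by auto
      then show "col (M * B) j = col (0\<^sub>m n d) j" using j by (simp add: col_mult2[OF M B])
    qed (use M B in auto)
    show "M *\<^sub>v (B *\<^sub>v a) = 0\<^sub>v n" if "a \<in> carrier_vec d" for a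
    proof -
      have "M *\<^sub>v (B *\<^sub>v a) = 0\<^sub>m n d *\<^sub>v a"
        using assoc_mult_mat_vec[OF M B that] MB by simp
      also have "\<dots> = 0\<^sub>v n" using that by (intro eq_vecI) (auto simp: scalar_prod_def)
      finally show ?thesis .
    qed
    show "\<exists>a \<in> carrier_vec d. v = B *\<^sub>v a" if "v \<in> carrier_vec n" "M *\<^sub>v v = 0\<^sub>v n" for v
    proof -
      have "v \<in> K.NC.span S" using that mat_kernel[OF M] basis(2) by auto
      then obtain f where "v = K.NC.lincomb f S" using K.NC.finite_in_span[OF finS Ssub] by blast
      then have "v = B *\<^sub>v vec d (\<lambda>i. f (col B i))"
        using K.NC.mat_mult_eq_lincomb[OF B] cols xs by simp
      then show ?thesis by (intro bexI[of _ "vec d (\<lambda>i. f (col B i))"]) auto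
    qed
    show "a = 0\<^sub>v d" if "a \<in> carrier_vec d" "B *\<^sub>v a = 0\<^sub>v n" for a
    proof (rule ccontr)
      assume "a \<noteq> 0\<^sub>v d"
      with K.NC.lin_depI[OF B that(1) _ that(2)] cols xs have "K.NC.lin_dep S" by simp
      with basis(1) show False by contradiction
    qed
  qed
qed

section \<open>Block boundaries and the index set of the constraints\<close>

abbreviation mu :: "nat list \<Rightarrow> nat \<Rightarrow> nat" where
  "mu ms l \<equiv> sum_list (take l ms)"

lemma mu_mono: "l \<le> l' \<Longrightarrow> mu ms l \<le> mu ms l'"
proof -
  assume "l \<le> l'"
  then obtain k where "l' = l + k" using le_Suc_ex by blast
  then show ?thesis by (simp add: take_add)
qed

lemma mu_le_sum_list: "mu ms l \<le> sum_list ms"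
proof -
  have "sum_list ms = sum_list (take l ms @ drop l ms)" by simp
  then show ?thesis unfolding sum_list_append by simp
qed

text \<open>Since \<open>mu\<close> is monotone, the set counted by \<open>blk\<close> is an initial
  segment starting at 1, so its cardinality is its largest element.\<close>

lemma mu_le_iff:
  assumes l: "l \<le> length ms"
  shows "mu ms l \<le> i \<longleftrightarrow> l \<le> blk ms i"
proof -
  let ?L = "{l. 1 \<le> l \<and> l \<le> length ms \<and> mu ms l \<le> i}"
  have fin: "finite ?L" by (rule finite_subset[of _ "{..length ms}"]) auto
  have L: "?L = {1..blk ms i}"
  proof (cases "?L = {}")
    case True
    then show ?thesis unfolding blk_def by simp
  next
    case False
    have "x \<in> ?L" if "1 \<le> x" "x \<le> Max ?L" for x
      using that Max_in[OF fin False] mu_mono[of x "Max ?L" ms] by auto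
    moreover have "1 \<le> x" "x \<le> Max ?L" if "x \<in> ?L" for x
      using that Max_ge[OF fin that] by auto
    ultimately have L': "?L = {1..Max ?L}" unfolding set_eq_iff atLeastAtMost_iff by blast
    then obtain M where M: "?L = {1..M}" by blast
    then have "blk ms i = M" unfolding blk_def by simp
    with M show ?thesis by simp
  qed
  then have "l \<in> ?L \<longleftrightarrow> l \<in> {1..blk ms i}" by simp
  then show ?thesis using l by (cases "l = 0") auto
qed

lemma blk_less_length:
  assumes "i < sum_list ms"
  shows "blk ms i < length ms"
  using mu_le_iff[of "length ms" ms i] assms by simp

text \<open>Block indices start at 0: \<open>mu ms (blk ms i)\<close> is where the block of
  \<open>i\<close> begins, and \<open>mu ms (Suc (blk ms i))\<close> is where the next one would
  begin.\<close>

lemma less_mu_blk_iff: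
  assumes "i < sum_list ms"
  shows "j < mu ms (blk ms i) \<longleftrightarrow> blk ms j < blk ms i"
  using mu_le_iff[of "blk ms i" ms j] blk_less_length[OF assms] by auto

lemma less_mu_Suc_blk_iff:
  assumes "i < sum_list ms"
  shows "j < mu ms (Suc (blk ms i)) \<longleftrightarrow> blk ms j \<le> blk ms i"
  using mu_le_iff[of "Suc (blk ms i)" ms j] blk_less_length[OF assms] by auto

lemma blk_mono: "i \<le> j \<Longrightarrow> blk ms i \<le> blk ms j"
  unfolding blk_def by (rule card_mono, rule finite_subset[of _ "{..length ms}"]) auto

lemma Phi_iff: "(i, r) \<in> Phi ms \<longleftrightarrow> i < sum_list ms \<and> i < r \<and> r < mu ms (Suc (blk ms i))"
proof -
  have "r < mu ms (Suc (blk ms i)) \<longleftrightarrow> r < sum_list ms \<and> blk ms i = blk ms r"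
    if "i < sum_list ms" "i < r"
  proof
    assume "r < mu ms (Suc (blk ms i))"
    then show "r < sum_list ms \<and> blk ms i = blk ms r"
      using less_mu_Suc_blk_iff[OF that(1), of r] blk_mono[of i r ms] that(2)
        mu_le_sum_list[of "Suc (blk ms i)" ms] by linarith
  next
    assume "r < sum_list ms \<and> blk ms i = blk ms r"
    then show "r < mu ms (Suc (blk ms i))" using less_mu_Suc_blk_iff[OF that(1), of r] by linarith
  qed
  moreover have "(i, r) \<in> Phi ms \<longleftrightarrow> i < sum_list ms \<and> r < sum_list ms \<and> i < r \<and> blk ms i = blk ms r"
    by (force simp: Phi_def Phi_list_def)
  ultimately show ?thesis by blast
qed

text \<open>The triangular conditions \<open>j \<le> i\<close> and those indexed by
  \<open>Phi\<close> together run exactly once through all \<open>r\<close> below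
  \<open>mu ms (Suc (blk ms i))\<close>. This number is the dimension of the kernel that has to
  contain column \<open>i\<close>, so the system for each column is square.\<close>

lemma constraint_indices_iff:
  "(\<forall>i < sum_list ms. \<forall>j \<le> i. P i j) \<and> (\<forall>(i, j) \<in> Phi ms. Q i j) \<longleftrightarrow>
    (\<forall>i < sum_list ms. \<forall>r < mu ms (Suc (blk ms i)). if r \<le> i then P i r else Q i r)"
    (is "?L1 \<and> ?L2 \<longleftrightarrow> ?R")
proof (rule iffI)
  assume L: "?L1 \<and> ?L2"
  show ?R
  proof (intro allI impI)
    fix i r assume i: "i < sum_list ms" and r: "r < mu ms (Suc (blk ms i))"
    show "if r \<le> i then P i r else Q i r"
    proof (cases "r \<le> i")
      case True
      then show ?thesis using L i by simp
    next
      case False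
      then have "(i, r) \<in> Phi ms" using i r by (simp add: Phi_iff)
      then show ?thesis using L False by auto
    qed
  qed
next
  assume R: ?R
  have "P i j" if "i < sum_list ms" "j \<le> i" for i j
  proof -
    have "j < mu ms (Suc (blk ms i))"
      using less_mu_Suc_blk_iff[OF that(1), of j] blk_mono[OF that(2), of ms] by simp
    then have "if j \<le> i then P i j else Q i j" using R that(1) by blast
    then show ?thesis using that(2) by simp
  qed
  moreover have "Q i j" if "(i, j) \<in> Phi ms" for i j
  proof -
    have ij: "i < sum_list ms" "i < j" "j < mu ms (Suc (blk ms i))" using that Phi_iff by blast+
    then have "if j \<le> i then P i j else Q i j" using R by blast
    then show ?thesis using ij(2) by simp
  qed
  ultimately show "?L1 \<and> ?L2" by blast
qed

section \<open>The flag of generalized eigenspaces\<close>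

lemma vec_eq_of_minus_eq_zero:
  fixes u v :: "'a :: group_add vec"
  assumes "u \<in> carrier_vec n" "v \<in> carrier_vec n" "u - v = 0\<^sub>v n"
  shows "u = v"
proof (rule eq_vecI)
  fix i assume i: "i < dim_vec v"
  have "(u - v) $ i = 0" using assms i by simp
  then show "u $ i = v $ i" using i by simp
qed (use assms in auto)

lemma mult_mat_vec_index_sum:
  assumes "A \<in> carrier_mat n d" "a \<in> carrier_vec d" "i < n"
  shows "(A *\<^sub>v a) $ i = (\<Sum>j<d. A $$ (i, j) * a $ j)"
  using assms by (simp add: scalar_prod_def atLeast0LessThan)

lemma herm_mult_mat_vec:
  assumes "x \<in> carrier_vec n" "Y \<in> carrier_mat n d" "a \<in> carrier_vec d"
  shows "herm x (Y *\<^sub>v a) = (\<Sum>j<d. herm x (col Y j) * a $ j)"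
proof -
  have "herm x (Y *\<^sub>v a) = (\<Sum>k<n. \<Sum>j<d. cnj (x $ k) * Y $$ (k, j) * a $ j)"
    using assms by (simp add: herm_def scalar_prod_def atLeast0LessThan sum_distrib_left mult.assoc)
  also have "\<dots> = (\<Sum>j<d. \<Sum>k<n. cnj (x $ k) * Y $$ (k, j) * a $ j)" by (rule sum.swap)
  also have "\<dots> = (\<Sum>j<d. herm x (col Y j) * a $ j)"
    using assms by (simp add: herm_def sum_distrib_right)
  finally show ?thesis .
qed

lemma herm_minus:
  assumes "x \<in> carrier_vec n" "u \<in> carrier_vec n" "v \<in> carrier_vec n"
  shows "herm x (u - v) = herm x u - herm x v"
  using assms by (simp add: herm_def right_diff_distrib sum_subtractf)

lemma herm_zero: "x \<in> carrier_vec n \<Longrightarrow> herm x (0\<^sub>v n) = 0"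
  by (simp add: herm_def)

text \<open>Used to show that the commutator in the linearized equation has trace zero.\<close>

lemma sum_diag_mult_commute:
  fixes P S :: "'a :: comm_semiring_0 mat"
  assumes "P \<in> carrier_mat m m" "S \<in> carrier_mat m m"
  shows "(\<Sum>i<m. (S * P) $$ (i, i)) = (\<Sum>i<m. (P * S) $$ (i, i))"
proof -
  have "(\<Sum>i<m. (S * P) $$ (i, i)) = (\<Sum>i<m. \<Sum>j<m. S $$ (i, j) * P $$ (j, i))"
    using assms by (intro sum.cong) (auto simp: scalar_prod_def atLeast0LessThan)
  also have "\<dots> = (\<Sum>j<m. \<Sum>i<m. S $$ (i, j) * P $$ (j, i))" by (rule sum.swap)
  also have "\<dots> = (\<Sum>i<m. (P * S) $$ (i, i))"
    using assms by (intro sum.cong) (auto simp: scalar_prod_def atLeast0LessThan mult.commute)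
  finally show ?thesis .
qed

lemma staircaseD:
  assumes "staircase ms S"
  shows "S \<in> carrier_mat (sum_list ms) (sum_list ms)"
    and "i < sum_list ms \<Longrightarrow> j < sum_list ms \<Longrightarrow> S $$ (j, i) \<noteq> 0 \<Longrightarrow> blk ms j < blk ms i"
  using assms unfolding staircase_def by (auto simp: not_le[symmetric])

lemma staircase_col:
  assumes "staircase ms S" "i < sum_list ms"
  shows "col S i \<in> carrier_vec (sum_list ms)"
    and "j < sum_list ms \<Longrightarrow> col S i $ j \<noteq> 0 \<Longrightarrow> blk ms j < blk ms i"
  using staircaseD[OF assms(1)] assms(2) by auto

text \<open>\<open>N\<close> stands for A - lambda I. The assumption \<open>stable\<close> says that
  the kernels of its powers stop growing after the last block.\<close>

locale staircase_flag =
  fixes N :: "complex mat" and n :: nat and ms :: "nat list"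
  assumes N: "N \<in> carrier_mat n n"
    and dims: "\<And>l. l \<le> length ms \<Longrightarrow> kernel_dim (N ^\<^sub>m l) = mu ms l"
    and stable: "kernel_dim (N ^\<^sub>m Suc (length ms)) = sum_list ms"
begin

abbreviation "m \<equiv> sum_list ms"

definition K :: "nat \<Rightarrow> complex vec set" where
  "K l = {v \<in> carrier_vec n. N ^\<^sub>m l *\<^sub>v v = 0\<^sub>v n}"

lemma K_carrier: "v \<in> K l \<Longrightarrow> v \<in> carrier_vec n"
  by (simp add: K_def)

lemma pow_carrier: "N ^\<^sub>m l \<in> carrier_mat n n"
  using N by simp

lemma K_Suc: "v \<in> carrier_vec n \<Longrightarrow> N *\<^sub>v v \<in> K l \<longleftrightarrow> v \<in> K (Suc l)"
  using N by (simp add: K_def assoc_mult_mat_vec[OF pow_carrier N])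

lemma K_mono_Suc: "v \<in> K l \<Longrightarrow> v \<in> K (Suc l)"
proof (induction l arbitrary: v)
  case 0
  then have "v = 0\<^sub>v n" using N by (auto simp: K_def)
  then show ?case using mult_mat_vec_zero[OF pow_carrier[of "Suc 0"]] by (simp add: K_def)
next
  case (Suc l)
  then have "N *\<^sub>v v \<in> K l" using K_Suc K_carrier by blast
  then have "N *\<^sub>v v \<in> K (Suc l)" by (rule Suc.IH)
  then show ?case using K_Suc K_carrier Suc.prems by blast
qed

lemma K_mono: "l \<le> l' \<Longrightarrow> v \<in> K l \<Longrightarrow> v \<in> K l'"
  by (induction l' rule: dec_induct) (auto intro: K_mono_Suc)

lemma K_add: "u \<in> K l \<Longrightarrow> v \<in> K l \<Longrightarrow> u + v \<in> K l"
  using mult_add_distrib_mat_vec[OF pow_carrier[of l]] by (simp add: K_def)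

text \<open>Columns with coefficient zero are unconstrained; this is how the zero pattern of a
  staircase matrix enters.\<close>

lemma K_mult_mat_vec:
  assumes Y: "Y \<in> carrier_mat n d" and a: "a \<in> carrier_vec d"
    and cols: "\<And>j. j < d \<Longrightarrow> a $ j \<noteq> 0 \<Longrightarrow> col Y j \<in> K l"
  shows "Y *\<^sub>v a \<in> K l"
proof -
  have "N ^\<^sub>m l *\<^sub>v (Y *\<^sub>v a) = (N ^\<^sub>m l * Y) *\<^sub>v a"
    by (rule assoc_mult_mat_vec[symmetric, OF pow_carrier Y a])
  also have "\<dots> = 0\<^sub>v n"
  proof (rule eq_vecI)
    fix i assume i: "i < dim_vec (0\<^sub>v n :: complex vec)"
    have entry: "(N ^\<^sub>m l * Y) $$ (i, j) * a $ j = 0" if j: "j < d" for j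
    proof (cases "a $ j = 0")
      case False
      then have "N ^\<^sub>m l *\<^sub>v col Y j = 0\<^sub>v n" using cols[OF j] by (simp add: K_def)
      then have "col (N ^\<^sub>m l * Y) j = 0\<^sub>v n" using col_mult2[OF pow_carrier Y j] by simp
      then have "col (N ^\<^sub>m l * Y) j $ i = 0" using i by (simp del: index_mult_mat(1))
      moreover have "(N ^\<^sub>m l * Y) $$ (i, j) = col (N ^\<^sub>m l * Y) j $ i"
        by (rule index_col[symmetric]) (use i j Y N in auto)
      ultimately show ?thesis by simp
    qed simp
    then show "((N ^\<^sub>m l * Y) *\<^sub>v a) $ i = 0\<^sub>v n $ i"
      using mult_mat_vec_index_sum[OF mult_carrier_mat[OF pow_carrier Y] a, of i l] i
        sum.neutral[of "{..<d}" "\<lambda>j. (N ^\<^sub>m l * Y) $$ (i, j) * a $ j"] entry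
      by (simp del: index_mult_mat(1) assoc_mult_mat_vec mult_eq_0_iff)
  qed (use N in simp)
  finally show ?thesis using Y a by (auto simp: K_def)
qed

lemma K_basis:
  assumes "l \<le> length ms"
  shows "\<exists>B \<in> carrier_mat n (mu ms l). (\<forall>a \<in> carrier_vec (mu ms l). B *\<^sub>v a \<in> K l) \<and>
    (\<forall>v \<in> K l. \<exists>a \<in> carrier_vec (mu ms l). v = B *\<^sub>v a) \<and>
    (\<forall>a \<in> carrier_vec (mu ms l). B *\<^sub>v a = 0\<^sub>v n \<longrightarrow> a = 0\<^sub>v (mu ms l))"
proof -
  obtain B where B: "B \<in> carrier_mat n (mu ms l)"
    "\<forall>a \<in> carrier_vec (mu ms l). N ^\<^sub>m l *\<^sub>v (B *\<^sub>v a) = 0\<^sub>v n"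
    "\<forall>v \<in> carrier_vec n. N ^\<^sub>m l *\<^sub>v v = 0\<^sub>v n \<longrightarrow> (\<exists>a \<in> carrier_vec (mu ms l). v = B *\<^sub>v a)"
    "\<forall>a \<in> carrier_vec (mu ms l). B *\<^sub>v a = 0\<^sub>v n \<longrightarrow> a = 0\<^sub>v (mu ms l)"
    using kernel_basis_mat[OF pow_carrier dims[OF assms, symmetric]] by blast
  show ?thesis
  proof (intro bexI[OF _ B(1)] conjI ballI)
    show "B *\<^sub>v a \<in> K l" if "a \<in> carrier_vec (mu ms l)" for a
      using B(1,2) that by (auto simp: K_def)
    show "\<exists>a \<in> carrier_vec (mu ms l). v = B *\<^sub>v a" if "v \<in> K l" for v
      using B(3) that by (simp add: K_def)
  qed (use B(4) in blast)
qed

text \<open>Both kernels have dimension \<open>m\<close> and one contains the other, so they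
  coincide.\<close>

lemma K_stable:
  assumes "v \<in> K (Suc (length ms))"
  shows "v \<in> K (length ms)"
proof -
  obtain B where B: "B \<in> carrier_mat n m"
    "\<And>a. a \<in> carrier_vec m \<Longrightarrow> B *\<^sub>v a \<in> K (length ms)"
    "\<And>a. a \<in> carrier_vec m \<Longrightarrow> B *\<^sub>v a = 0\<^sub>v n \<Longrightarrow> a = 0\<^sub>v m"
    using K_basis[OF order_refl, unfolded take_all[OF order_refl]] by blast
  obtain B' where B': "B' \<in> carrier_mat n m"
    "\<forall>v \<in> carrier_vec n. N ^\<^sub>m Suc (length ms) *\<^sub>v v = 0\<^sub>v n \<longrightarrow> (\<exists>a \<in> carrier_vec m. v = B' *\<^sub>v a)"
    using kernel_basis_mat[OF pow_carrier stable[symmetric]] by blast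
  have col: "\<exists>a \<in> carrier_vec m. col B j = B' *\<^sub>v a" if j: "j < m" for j
  proof -
    have "col B j = B *\<^sub>v unit_vec m j" using col_mult2[OF B(1) one_carrier_mat j] B(1) j by simp
    then have "col B j \<in> K (Suc (length ms))" using B(2)[of "unit_vec m j"] K_mono_Suc by simp
    then show ?thesis using B'(2) unfolding K_def by blast
  qed
  obtain a where a: "a \<in> carrier_vec m" "v = B' *\<^sub>v a"
    using assms B'(2) unfolding K_def by blast
  from range_mat_eq_of_subset[OF B'(1) B(1,3) col a(1)] a(2) B(2) show ?thesis by metis
qed

text \<open>Induction on the column: by the staircase shape, \<open>N\<close> maps column
  \<open>i\<close> to a combination of columns of earlier blocks plus a column of \<open>W\<close>,
  all in \<open>K (g i)\<close>. So column \<open>i\<close> lies one level higher, and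
  \<open>lift\<close> converts this to level \<open>f i\<close>. It is applied with
  \<open>g = blk ms\<close> and \<open>f\<close> one larger, and with both constantly
  \<open>length ms\<close>, where \<open>lift\<close> is stability.\<close>

lemma staircase_recursion:
  assumes Z: "Z \<in> carrier_mat n m" and W: "W \<in> carrier_mat n m" and S: "staircase ms S"
    and eq: "N * Z = Z * S + W" and WK: "\<And>i. i < m \<Longrightarrow> col W i \<in> K (g i)"
    and lift: "\<And>i v. i < m \<Longrightarrow> v \<in> K (Suc (g i)) \<Longrightarrow> v \<in> K (f i)"
    and step: "\<And>i j. i < m \<Longrightarrow> j < m \<Longrightarrow> blk ms j < blk ms i \<Longrightarrow> f j \<le> g i"
    and i: "i < m"
  shows "col Z i \<in> K (f i)"
  using i
proof (induction i rule: less_induct)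
  case (less i)
  note S' = staircaseD(1)[OF S]
  have "N *\<^sub>v col Z i = col (Z * S + W) i"
    unfolding eq[symmetric] by (rule col_mult2[symmetric, OF N Z less.prems])
  also have "\<dots> = col (Z * S) i + col W i"
    using Z S' W less.prems by (intro col_add) auto
  also have "col (Z * S) i = Z *\<^sub>v col S i" by (rule col_mult2[OF Z S' less.prems])
  finally have NZ: "N *\<^sub>v col Z i = Z *\<^sub>v col S i + col W i" .
  have "Z *\<^sub>v col S i \<in> K (g i)"
  proof (rule K_mult_mat_vec[OF Z staircase_col(1)[OF S less.prems]])
    fix j assume j: "j < m" "col S i $ j \<noteq> 0"
    then have lt: "blk ms j < blk ms i" using staircase_col[OF S less.prems] by blast
    then have "j < i" using blk_mono[of i j ms] by (meson not_le)
    then show "col Z j \<in> K (g i)" using less.IH[OF _ j(1)] K_mono step[OF less.prems j(1) lt] by blast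
  qed
  then have "N *\<^sub>v col Z i \<in> K (g i)" unfolding NZ using K_add WK[OF less.prems] by simp
  then show ?case using K_Suc[of "col Z i"] Z lift[OF less.prems] less.prems by simp
qed

end

text \<open>General position of \<open>b\<close> and \<open>c\<close>: on the kernel belonging to
  column \<open>i\<close>, the square system of functionals has trivial null space and attains the
  unit vector with index \<open>i\<close>.\<close>

locale generic_flag = staircase_flag +
  fixes b c :: "nat \<Rightarrow> complex vec"
  assumes b: "\<And>j. b j \<in> carrier_vec n" and c: "\<And>j. c j \<in> carrier_vec n"
    and unique: "\<And>i v. i < m \<Longrightarrow> v \<in> K (Suc (blk ms i)) \<Longrightarrow>
      (\<And>r. r < mu ms (Suc (blk ms i)) \<Longrightarrow> herm (if r \<le> i then c r else b r) v = 0) \<Longrightarrow> v = 0\<^sub>v n"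
    and exist: "\<And>i. i < m \<Longrightarrow> \<exists>v \<in> K (Suc (blk ms i)). \<forall>r < mu ms (Suc (blk ms i)).
      herm (if r \<le> i then c r else b r) v = (if r = i then 1 else 0)"
begin

text \<open>The parameter \<open>e\<close> is the diagonal normalization: constantly 1 for a
  solution, constantly 0 for a tangent direction.\<close>

definition constrained :: "(nat \<Rightarrow> complex) \<Rightarrow> complex mat \<Rightarrow> bool" where
  "constrained e Y \<longleftrightarrow> (\<forall>i < m. \<forall>r < mu ms (Suc (blk ms i)).
      herm (if r \<le> i then c r else b r) (col Y i) = (if r = i then e i else 0))"

lemma constrained_c:
  assumes "constrained e Y" "i < m" "j \<le> i"
  shows "herm (c j) (col Y i) = (if j = i then e i else 0)"
proof -
  have "j < mu ms (Suc (blk ms i))"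
    using less_mu_Suc_blk_iff[OF assms(2), of j] blk_mono[OF assms(3), of ms] by simp
  then have "herm (if j \<le> i then c j else b j) (col Y i) = (if j = i then e i else 0)"
    using assms(1,2) unfolding constrained_def by blast
  then show ?thesis using assms(3) by simp
qed

text \<open>Forward substitution: apply \<open>c j\<close> to the relation. Terms with
  \<open>i > j\<close> vanish by the constraints, terms with \<open>i < j\<close> by induction, and
  the diagonal term is \<open>a $ j\<close>.\<close>

lemma constrained_inj:
  assumes Y: "Y \<in> carrier_mat n m" and con: "constrained (\<lambda>_. 1) Y"
    and a: "a \<in> carrier_vec m" and 0: "Y *\<^sub>v a = 0\<^sub>v n"
  shows "a = 0\<^sub>v m"
proof -
  have "a $ j = 0" if "j < m" for j
    using that
  proof (induction j rule: less_induct)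
    case (less j)
    have "0 = (\<Sum>i<m. herm (c j) (col Y i) * a $ i)"
      using herm_mult_mat_vec[OF c Y a, of j] 0 herm_zero[OF c] by simp
    also have "\<dots> = (\<Sum>i<m. if i = j then a $ i else 0)"
    proof (intro sum.cong refl)
      fix i assume "i \<in> {..<m}"
      then have i: "i < m" by simp
      show "herm (c j) (col Y i) * a $ i = (if i = j then a $ i else 0)"
        using less.IH[OF _ i] constrained_c[OF con i, of j] by (cases i j rule: linorder_cases) auto
    qed
    also have "\<dots> = a $ j" using less.prems by simp
    finally show ?case by simp
  qed
  then show ?thesis using a by (intro eq_vecI) auto
qed

lemma constrained_mat_inj:
  assumes Y: "Y \<in> carrier_mat n m" and con: "constrained (\<lambda>_. 1) Y"
    and P: "P \<in> carrier_mat m d" and Q: "Q \<in> carrier_mat m d" and eq: "Y * P = Y * Q"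
  shows "P = Q"
proof (rule mat_col_eqI)
  fix j assume "j < dim_col Q"
  then have j: "j < d" using Q by simp
  have "Y *\<^sub>v (col P j - col Q j) = Y *\<^sub>v col P j - Y *\<^sub>v col Q j"
    using P Q j by (intro mult_minus_distrib_mat_vec[OF Y]) auto
  also have "\<dots> = col (Y * P) j - col (Y * Q) j"
    by (simp only: col_mult2[OF Y P j] col_mult2[OF Y Q j])
  also have "\<dots> = 0\<^sub>v n" unfolding eq using Y Q j by (intro eq_vecI) auto
  finally have "col P j - col Q j = 0\<^sub>v m"
    using constrained_inj[OF Y con] P Q j by simp
  then show "col P j = col Q j" using vec_eq_of_minus_eq_zero P Q j by (metis carrier_matD(1) col_carrier_vec carrier_matD(2))
qed (use P Q in auto)

text \<open>The first \<open>mu ms l\<close> columns of \<open>Y\<close> lie in \<open>K l\<close>,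
  are independent and match its dimension, so they span it. The vanishing of the other coefficients
  later yields the staircase pattern.\<close>

lemma K_spanned:
  assumes Y: "Y \<in> carrier_mat n m" and con: "constrained (\<lambda>_. 1) Y"
    and cols: "\<And>i. i < m \<Longrightarrow> col Y i \<in> K (Suc (blk ms i))"
    and l: "l \<le> length ms" and v: "v \<in> K l"
  shows "\<exists>a \<in> carrier_vec m. Y *\<^sub>v a = v \<and> (\<forall>j < m. mu ms l \<le> j \<longrightarrow> a $ j = 0)"
proof -
  let ?d = "mu ms l"
  have dm: "?d \<le> m" by (rule mu_le_sum_list)
  obtain B where B: "B \<in> carrier_mat n ?d"
    "\<And>v. v \<in> K l \<Longrightarrow> \<exists>a \<in> carrier_vec ?d. v = B *\<^sub>v a"
    using K_basis[OF l] by blast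
  define Y' where "Y' = mat n ?d (\<lambda>(i, j). Y $$ (i, j))"
  have Y': "Y' \<in> carrier_mat n ?d" by (simp add: Y'_def)
  \<comment> \<open>Padding with zeros transfers statements about \<open>Y\<close> to its leading
    columns \<open>Y'\<close> and back.\<close>
  define pad where "pad a = vec m (\<lambda>j. if j < ?d then a $ j else 0)" for a :: "complex vec"
  have pad: "pad a \<in> carrier_vec m" for a by (simp add: pad_def)
  have Ypad: "Y *\<^sub>v pad a = Y' *\<^sub>v a" if a: "a \<in> carrier_vec ?d" for a
  proof (rule eq_vecI)
    fix i assume "i < dim_vec (Y' *\<^sub>v a)"
    then have i: "i < n" using Y' by simp
    have "(Y *\<^sub>v pad a) $ i = (\<Sum>j<m. if j < ?d then Y $$ (i, j) * a $ j else 0)"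
      using i Y by (auto simp: scalar_prod_def atLeast0LessThan pad_def intro!: sum.cong)
    also have "\<dots> = (\<Sum>j<?d. Y $$ (i, j) * a $ j)"
      by (rule sum.mono_neutral_cong_right) (use dm in auto)
    also have "\<dots> = (Y' *\<^sub>v a) $ i"
      using i a Y' by (simp add: scalar_prod_def atLeast0LessThan Y'_def)
    finally show "(Y *\<^sub>v pad a) $ i = (Y' *\<^sub>v a) $ i" .
  qed (use Y Y' in simp)
  have inj: "a = 0\<^sub>v ?d" if a: "a \<in> carrier_vec ?d" "Y' *\<^sub>v a = 0\<^sub>v n" for a
  proof -
    have p: "pad a = 0\<^sub>v m" using constrained_inj[OF Y con pad] Ypad a by simp
    have "a $ j = 0" if "j < ?d" for j
      using arg_cong[OF p, of "\<lambda>x. x $ j"] that dm by (simp add: pad_def)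
    then show ?thesis using a by (intro eq_vecI) auto
  qed
  have "\<exists>a \<in> carrier_vec ?d. col Y' j = B *\<^sub>v a" if j: "j < ?d" for j
  proof (rule B(2))
    have jm: "j < m" using j dm by simp
    then have "col Y' j = col Y j" using j Y by (intro eq_vecI) (auto simp: Y'_def)
    moreover have "Suc (blk ms j) \<le> l" using mu_le_iff[OF l, of j] j by simp
    ultimately show "col Y' j \<in> K l" using cols[OF jm] K_mono by simp
  qed
  moreover obtain a where a: "a \<in> carrier_vec ?d" "v = B *\<^sub>v a" using B(2)[OF v] by blast
  ultimately obtain a' where "a' \<in> carrier_vec ?d" "Y' *\<^sub>v a' = v"
    using range_mat_eq_of_subset[OF B(1) Y' inj] by metis
  then have "Y *\<^sub>v pad a' = v" using Ypad by simp
  then show ?thesis using pad by (intro bexI[of _ "pad a'"]) (auto simp: pad_def)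
qed

section \<open>Existence, uniqueness and linearization of the normalized solution\<close>

definition solution :: "complex mat \<Rightarrow> complex mat \<Rightarrow> bool" where
  "solution Y S \<longleftrightarrow> Y \<in> carrier_mat n m \<and> staircase ms S \<and> N * Y = Y * S \<and> constrained (\<lambda>_. 1) Y"

lemma solution_cols:
  assumes "solution Y S" "i < m"
  shows "col Y i \<in> K (Suc (blk ms i))"
proof (rule staircase_recursion[where S = S and W = "0\<^sub>m n m" and g = "blk ms"])
  have "Y * S \<in> carrier_mat n m" using assms staircaseD(1)[of ms S] by (auto simp: solution_def)
  then show "N * Y = Y * S + 0\<^sub>m n m" using assms by (simp add: solution_def)
  show "col (0\<^sub>m n m) i \<in> K (blk ms i)" if "i < m" for i
    using that mult_mat_vec_zero[OF pow_carrier[of "blk ms i"]] by (simp add: K_def)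
qed (use assms in \<open>auto simp: solution_def\<close>)

text \<open>The difference of corresponding columns lies in the right kernel and satisfies the
  homogeneous system, so it is zero; cancelling \<open>Y\<close> on the left then identifies the
  staircase factors.\<close>

lemma solution_unique:
  assumes 1: "solution Y S" and 2: "solution Y' S'"
  shows "Y = Y' \<and> S = S'"
proof -
  have Y: "Y \<in> carrier_mat n m" "Y' \<in> carrier_mat n m" using 1 2 by (auto simp: solution_def)
  have con: "constrained (\<lambda>_. 1) Y" "constrained (\<lambda>_. 1) Y'" using 1 2 by (auto simp: solution_def)
  have eq: "Y = Y'"
  proof (rule mat_col_eqI)
    fix i assume "i < dim_col Y'"
    then have i: "i < m" using Y by simp
    let ?u = "col Y i" and ?v = "col Y' i"
    have uv: "?u \<in> K (Suc (blk ms i))" "?v \<in> K (Suc (blk ms i))"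
      using solution_cols 1 2 i by auto
    then have car: "?u \<in> carrier_vec n" "?v \<in> carrier_vec n" by (auto dest: K_carrier)
    have "?u - ?v = 0\<^sub>v n"
    proof (rule unique[OF i])
      show "?u - ?v \<in> K (Suc (blk ms i))"
        using uv mult_minus_distrib_mat_vec[OF pow_carrier[of "Suc (blk ms i)"] car]
        by (simp add: K_def del: pow_mat.simps)
      fix r assume r: "r < mu ms (Suc (blk ms i))"
      have "(if r \<le> i then c r else b r) \<in> carrier_vec n" using b c by simp
      from herm_minus[OF this car] show "herm (if r \<le> i then c r else b r) (?u - ?v) = 0"
        using con i r unfolding constrained_def by simp
    qed
    then show "?u = ?v" by (rule vec_eq_of_minus_eq_zero[OF car])
  qed (use Y in auto)
  have "Y * S = Y * S'" using 1 2 eq by (metis solution_def)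
  moreover have "S \<in> carrier_mat m m" "S' \<in> carrier_mat m m"
    using 1 2 staircaseD(1) by (auto simp: solution_def)
  ultimately have "S = S'" using constrained_mat_inj[OF Y(1) con(1)] by blast
  with eq show ?thesis by simp
qed

text \<open>Take the columns of \<open>Y\<close> from \<open>exist\<close>. As \<open>N\<close>
  lowers the level by one, its value on column \<open>i\<close> is a combination of the columns in
  strictly earlier blocks, and the coefficients form column \<open>i\<close> of
  \<open>S\<close>.\<close>

lemma solution_exists: "\<exists>Y S. solution Y S"
proof -
  from exist obtain y where y: "\<And>i. i < m \<Longrightarrow> y i \<in> K (Suc (blk ms i))"
    "\<And>i r. i < m \<Longrightarrow> r < mu ms (Suc (blk ms i)) \<Longrightarrow>
      herm (if r \<le> i then c r else b r) (y i) = (if r = i then 1 else 0)"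
    by metis
  define Y where "Y = mat n m (\<lambda>(k, i). y i $ k)"
  have Y: "Y \<in> carrier_mat n m" by (simp add: Y_def)
  have col: "col Y i = y i" if "i < m" for i
    using that K_carrier[OF y(1)[OF that]] by (intro eq_vecI) (auto simp: Y_def)
  have con: "constrained (\<lambda>_. 1) Y" using y(2) col by (simp add: constrained_def)
  have cols: "col Y i \<in> K (Suc (blk ms i))" if "i < m" for i using y(1) col that by simp
  have "\<exists>a \<in> carrier_vec m. Y *\<^sub>v a = N *\<^sub>v y i \<and> (\<forall>j < m. mu ms (blk ms i) \<le> j \<longrightarrow> a $ j = 0)"
    if i: "i < m" for i
  proof (rule K_spanned[OF Y con cols])
    show "blk ms i \<le> length ms" using blk_less_length[OF i] by simp
    show "N *\<^sub>v y i \<in> K (blk ms i)" using y(1)[OF i] K_Suc K_carrier by blast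
  qed
  then obtain s where s: "\<And>i. i < m \<Longrightarrow> s i \<in> carrier_vec m"
    "\<And>i. i < m \<Longrightarrow> Y *\<^sub>v s i = N *\<^sub>v y i"
    "\<And>i j. i < m \<Longrightarrow> j < m \<Longrightarrow> mu ms (blk ms i) \<le> j \<Longrightarrow> s i $ j = 0"
    by metis
  define S where "S = mat m m (\<lambda>(j, i). s i $ j)"
  have S: "S \<in> carrier_mat m m" by (simp add: S_def)
  have colS: "col S i = s i" if "i < m" for i
    using that s(1)[OF that] by (intro eq_vecI) (auto simp: S_def)
  have "staircase ms S"
    unfolding staircase_def
  proof (intro conjI allI impI S)
    fix i j assume ij: "i < m" "j < m" "blk ms j \<le> blk ms i"
    then have "mu ms (blk ms j) \<le> i" using less_mu_blk_iff[OF ij(2), of i] by (simp add: not_less)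
    then show "S $$ (i, j) = 0" using s(3)[OF ij(2,1)] ij by (simp add: S_def)
  qed
  moreover have "N * Y = Y * S"
  proof (rule mat_col_eqI)
    fix i assume "i < dim_col (Y * S)"
    then have i: "i < m" using S by simp
    show "col (N * Y) i = col (Y * S) i"
      using s(2)[OF i] by (simp add: col_mult2[OF N Y i] col_mult2[OF Y S i] colS[OF i] col[OF i])
  qed (use N Y S in auto)
  ultimately show ?thesis using Y con by (auto simp: solution_def)
qed

text \<open>The equation is the derivative of the residual in the direction
  \<open>(\<sigma>, Z, T)\<close>. The term with \<open>\<sigma>\<close> does not lower the level in
  the flag, so a first pass places the columns of \<open>Z\<close> only in the largest kernel. This
  suffices for the trace argument, and once \<open>\<sigma> = 0\<close> a second pass places every
  column at its proper level.\<close>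

lemma linearization_injective:
  assumes sol: "solution Y S" and Z: "Z \<in> carrier_mat n m" and T: "staircase ms T"
    and eq: "N * Z = Z * S + (\<sigma> \<cdot>\<^sub>m Y + Y * T)" and con: "constrained (\<lambda>_. 0) Z" and m: "0 < m"
  shows "\<sigma> = 0 \<and> Z = 0\<^sub>m n m \<and> T = 0\<^sub>m m m"
proof -
  have Y: "Y \<in> carrier_mat n m" and S: "staircase ms S" and NY: "N * Y = Y * S"
    and conY: "constrained (\<lambda>_. 1) Y"
    using sol by (auto simp: solution_def)
  note S' = staircaseD(1)[OF S] and T' = staircaseD(1)[OF T]
  have colsY: "col Y i \<in> K (length ms)" if "i < m" for i
    using solution_cols[OF sol that] K_mono blk_less_length[OF that] by (meson Suc_leI)
  define U where "U = \<sigma> \<cdot>\<^sub>m 1\<^sub>m m + T"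
  have U: "U \<in> carrier_mat m m" using T' by (simp add: U_def)
  have W: "\<sigma> \<cdot>\<^sub>m Y + Y * T = Y * U"
    unfolding U_def using Y T'
    by (simp add: mult_add_distrib_mat[OF Y _ T'] mult_smult_distrib[OF Y one_carrier_mat])
  have WK: "col (Y * U) i \<in> K (length ms)" if "i < m" for i
    using that U colsY by (simp add: col_mult2[OF Y U that]) (intro K_mult_mat_vec[OF Y], auto)
  have "col Z i \<in> K (length ms)" if "i < m" for i
    by (rule staircase_recursion[OF Z _ S eq[unfolded W] WK K_stable _ that]) (use Y U in auto)
  then have "\<exists>a \<in> carrier_vec m. Y *\<^sub>v a = col Z i" if "i < m" for i
    using K_spanned[OF Y conY solution_cols[OF sol] order_refl] that by blast
  then obtain p where p: "\<And>i. i < m \<Longrightarrow> p i \<in> carrier_vec m" "\<And>i. i < m \<Longrightarrow> Y *\<^sub>v p i = col Z i"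
    by metis
  define P where "P = mat m m (\<lambda>(j, i). p i $ j)"
  have P: "P \<in> carrier_mat m m" by (simp add: P_def)
  have colP: "col P i = p i" if "i < m" for i
    using that p(1)[OF that] by (intro eq_vecI) (auto simp: P_def)
  have ZP: "Z = Y * P"
  proof (rule mat_col_eqI)
    fix i assume "i < dim_col (Y * P)"
    then have i: "i < m" using P by simp
    show "col Z i = col (Y * P) i" unfolding col_mult2[OF Y P i] colP[OF i] p(2)[OF i] ..
  qed (use Z Y P in auto)
  have "Y * (S * P) = N * Y * P"
    unfolding NY by (rule assoc_mult_mat[symmetric, OF Y S' P])
  also have "\<dots> = N * Z" unfolding ZP by (rule assoc_mult_mat[OF N Y P])
  also have "\<dots> = Z * S + Y * U" by (rule eq[unfolded W])
  also have "\<dots> = Y * P * S + Y * U" by (simp only: ZP)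
  also have "\<dots> = Y * (P * S) + Y * U" by (simp only: assoc_mult_mat[OF Y P S'])
  also have "\<dots> = Y * (P * S + U)"
    using P S' by (intro mult_add_distrib_mat[symmetric, OF Y _ U]) auto
  \<comment> \<open>Independence of the columns of \<open>Y\<close> reduces everything to a
    commutator identity between \<open>m\<close> by \<open>m\<close> matrices.\<close>
  finally have SP: "S * P = P * S + U"
    by (rule constrained_mat_inj[OF Y conY, rotated 2]) (use S' P U in auto)
  have "(\<Sum>i<m. (S * P) $$ (i, i)) = (\<Sum>i<m. (P * S) $$ (i, i)) + (\<Sum>i<m. U $$ (i, i))"
    unfolding SP sum.distrib[symmetric] using S' P U by (intro sum.cong) auto
  then have "(\<Sum>i<m. U $$ (i, i)) = 0" using sum_diag_mult_commute[OF P S'] by simp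
  \<comment> \<open>A staircase matrix has zero diagonal, so the trace of \<open>U\<close> is
    \<open>m\<close> times \<open>\<sigma>\<close>; \<open>0 < m\<close> then gives
    \<open>\<sigma> = 0\<close>.\<close>
  moreover have "U $$ (i, i) = \<sigma>" if "i < m" for i
    using that T T' by (simp add: U_def staircase_def)
  ultimately have \<sigma>: "\<sigma> = 0" using m by (simp del: sum_list_eq_0_iff)
  have YT: "Y * T \<in> carrier_mat n m" using Y T' by simp
  have "0 \<cdot>\<^sub>m Y + Y * T = Y * T"
  proof -
    have "0 \<cdot>\<^sub>m Y = 0\<^sub>m n m" using Y by (intro eq_matI) auto
    then show ?thesis using left_add_zero_mat[OF YT] by simp
  qed
  then have eq0: "N * Z = Z * S + Y * T" using eq \<sigma> by simp
  have "col Z i = 0\<^sub>v n" if i: "i < m" for i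
  proof (rule unique[OF i])
    \<comment> \<open>Second pass: the remaining inhomogeneity \<open>Y * T\<close> combines, in
      column \<open>i\<close>, only columns of strictly earlier blocks.\<close>
    show "col Z i \<in> K (Suc (blk ms i))"
    proof (rule staircase_recursion[OF Z _ S eq0 _ _ _ i, where g = "blk ms"])
      fix i assume i: "i < m"
      show "col (Y * T) i \<in> K (blk ms i)"
        unfolding col_mult2[OF Y T' i]
      proof (rule K_mult_mat_vec[OF Y staircase_col(1)[OF T i]])
        fix j assume j: "j < m" "col T i $ j \<noteq> 0"
        then have "Suc (blk ms j) \<le> blk ms i" using staircase_col(2)[OF T i] by (simp add: Suc_leI)
        then show "col Y j \<in> K (blk ms i)" using solution_cols[OF sol j(1)] K_mono by blast
      qed
    qed (use YT in \<open>auto simp: Suc_le_eq\<close>)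
    show "herm (if r \<le> i then c r else b r) (col Z i) = 0" if "r < mu ms (Suc (blk ms i))" for r
      using con i that unfolding constrained_def by auto
  qed
  then have Z0: "Z = 0\<^sub>m n m" by (intro mat_col_eqI) (use Z in auto)
  have "N * Z = 0\<^sub>m n m" "Z * S = 0\<^sub>m n m" unfolding Z0 using N S' by auto
  then have "Y * T = 0\<^sub>m n m" using eq0 left_add_zero_mat[OF YT] by simp
  then have "Y * T = Y * 0\<^sub>m m m" using Y by simp
  from constrained_mat_inj[OF Y conY T' _ this] have "T = 0\<^sub>m m m" by simp
  with \<sigma> Z0 show ?thesis by simp
qed

end

section \<open>Directional derivatives and the Jacobian\<close>

text \<open>A trivial kernel makes the columns independent. Independence concerns the set of
  columns, so distinctness is shown first: two equal columns would put a difference of unit vectors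
  in the kernel.\<close>

lemma rank_eq_dim_colI:
  fixes J :: "'a :: field mat"
  assumes J: "J \<in> carrier_mat nr nc"
    and inj: "\<And>x. x \<in> carrier_vec nc \<Longrightarrow> J *\<^sub>v x = 0\<^sub>v nr \<Longrightarrow> x = 0\<^sub>v nc"
  shows "vec_space.rank nr J = nc"
proof -
  interpret vec_space "TYPE('a)" nr .
  have dist: "distinct (cols J)"
  proof (rule ccontr)
    assume "\<not> distinct (cols J)"
    then obtain i j where ij: "i < nc" "j < nc" "i \<noteq> j" "col J i = col J j"
      using J by (auto simp: distinct_conv_nth)
    let ?x = "unit_vec nc i - unit_vec nc j :: 'a vec"
    have unit: "J *\<^sub>v unit_vec nc k = col J k" if "k < nc" for k
      using col_mult2[OF J one_carrier_mat that] that J by simp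
    have "J *\<^sub>v ?x = J *\<^sub>v unit_vec nc i - J *\<^sub>v unit_vec nc j"
      by (rule mult_minus_distrib_mat_vec[OF J]) auto
    also have "\<dots> = 0\<^sub>v nr" using unit ij J by (intro eq_vecI) auto
    finally have "?x = 0\<^sub>v nc" by (intro inj) auto
    then have "?x $ i = 0" using ij by simp
    then show False using ij by simp
  qed
  have "lin_indpt (set (cols J))"
  proof
    assume "lin_dep (set (cols J))"
    from lin_depE[OF J this dist] obtain v where "v \<in> carrier_vec nc" "v \<noteq> 0\<^sub>v nc" "J *\<^sub>v v = 0\<^sub>v nr" .
    with inj show False by blast
  qed
  from lin_indpt_full_rank[OF J dist this] show ?thesis .
qed

text \<open>Only the partial derivatives in the coordinates of \<open>V\<close> are required;
  \<open>d\<close> is their product with \<open>X\<close>, that is, a Jacobian row applied to a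
  vector. The rules below compute this product without listing the entries.\<close>

definition has_dir_deriv ::
  "'v set \<Rightarrow> ('v \<Rightarrow> complex) \<Rightarrow> ('v \<Rightarrow> complex) \<Rightarrow> (('v \<Rightarrow> complex) \<Rightarrow> complex) \<Rightarrow> complex \<Rightarrow> bool" where
  "has_dir_deriv V q X F d \<longleftrightarrow> (\<exists>\<delta>. (\<forall>v \<in> V. ((\<lambda>t. F (q(v := t))) has_field_derivative \<delta> v) (at (q v))) \<and>
    d = (\<Sum>v\<in>V. \<delta> v * X v))"

lemma has_dir_deriv_const: "has_dir_deriv V q X (\<lambda>_. a) 0"
  unfolding has_dir_deriv_def by (intro exI[of _ "\<lambda>_. 0"]) auto

text \<open>A coordinate outside \<open>V\<close> counts as a constant, as the entries of
  \<open>S\<close> forced to be zero should.\<close>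

lemma has_dir_deriv_coord:
  assumes "finite V"
  shows "has_dir_deriv V q X (\<lambda>p. p w) (if w \<in> V then X w else 0)"
proof -
  have "((\<lambda>t. (q(v := t)) w) has_field_derivative (if v = w then 1 else 0)) (at (q v))" for v
    by (cases "v = w") auto
  moreover have "(\<Sum>v\<in>V. (if v = w then 1 else 0) * X v) = (\<Sum>v\<in>V. if v = w then X v else 0)"
    by (intro sum.cong) auto
  ultimately show ?thesis
    unfolding has_dir_deriv_def using assms
    by (intro exI[of _ "\<lambda>v. if v = w then 1 else 0"]) (simp add: sum.delta)
qed

lemma has_dir_deriv_add:
  assumes "has_dir_deriv V q X F d" "has_dir_deriv V q X G e"
  shows "has_dir_deriv V q X (\<lambda>p. F p + G p) (d + e)"
proof -
  obtain \<delta> \<epsilon> where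
    "\<forall>v\<in>V. ((\<lambda>t. F (q(v := t))) has_field_derivative \<delta> v) (at (q v))" "d = (\<Sum>v\<in>V. \<delta> v * X v)"
    "\<forall>v\<in>V. ((\<lambda>t. G (q(v := t))) has_field_derivative \<epsilon> v) (at (q v))" "e = (\<Sum>v\<in>V. \<epsilon> v * X v)"
    using assms unfolding has_dir_deriv_def by auto
  then show ?thesis unfolding has_dir_deriv_def
    by (intro exI[of _ "\<lambda>v. \<delta> v + \<epsilon> v"]) (auto intro!: derivative_intros simp: sum.distrib algebra_simps)
qed

lemma has_dir_deriv_mult:
  assumes "has_dir_deriv V q X F d" "has_dir_deriv V q X G e"
  shows "has_dir_deriv V q X (\<lambda>p. F p * G p) (d * G q + F q * e)"
proof -
  obtain \<delta> \<epsilon> where *: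
    "\<forall>v\<in>V. ((\<lambda>t. F (q(v := t))) has_field_derivative \<delta> v) (at (q v))" "d = (\<Sum>v\<in>V. \<delta> v * X v)"
    "\<forall>v\<in>V. ((\<lambda>t. G (q(v := t))) has_field_derivative \<epsilon> v) (at (q v))" "e = (\<Sum>v\<in>V. \<epsilon> v * X v)"
    using assms unfolding has_dir_deriv_def by auto
  have "((\<lambda>t. F (q(v := t)) * G (q(v := t))) has_field_derivative (\<delta> v * G q + F q * \<epsilon> v)) (at (q v))"
    if "v \<in> V" for v
  proof -
    have "((\<lambda>t. F (q(v := t))) has_field_derivative \<delta> v) (at (q v))"
      and "((\<lambda>t. G (q(v := t))) has_field_derivative \<epsilon> v) (at (q v))"
      using * that by blast+
    from DERIV_mult'[OF this] show ?thesis by (simp only: fun_upd_triv add.commute)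
  qed
  moreover have "d * G q + F q * e = (\<Sum>v\<in>V. (\<delta> v * G q + F q * \<epsilon> v) * X v)"
    unfolding *(2,4) by (simp add: distrib_right distrib_left sum.distrib sum_distrib_left sum_distrib_right mult_ac)
  ultimately show ?thesis
    unfolding has_dir_deriv_def by (intro exI[of _ "\<lambda>v. \<delta> v * G q + F q * \<epsilon> v"]) simp
qed

lemma has_dir_deriv_cmult:
  assumes "has_dir_deriv V q X F d"
  shows "has_dir_deriv V q X (\<lambda>p. a * F p) (a * d)"
  using has_dir_deriv_mult[OF has_dir_deriv_const assms] by simp

lemma has_dir_deriv_diff:
  assumes "has_dir_deriv V q X F d" "has_dir_deriv V q X G e"
  shows "has_dir_deriv V q X (\<lambda>p. F p - G p) (d - e)"
  using has_dir_deriv_add[OF assms(1) has_dir_deriv_cmult[OF assms(2), of "-1"]] by simp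

lemma has_dir_deriv_sum:
  assumes "\<And>k. k \<in> I \<Longrightarrow> has_dir_deriv V q X (F k) (d k)"
  shows "has_dir_deriv V q X (\<lambda>p. \<Sum>k\<in>I. F k p) (\<Sum>k\<in>I. d k)"
  using assms
  by (induction I rule: infinite_finite_induct) (auto intro: has_dir_deriv_const has_dir_deriv_add)

lemma has_dir_deriv_imp_sum_deriv:
  assumes "has_dir_deriv V q X F d"
  shows "(\<Sum>v\<in>V. deriv (\<lambda>t. F (q(v := t))) (q v) * X v) = d"
proof -
  obtain \<delta> where *:
    "\<forall>v\<in>V. ((\<lambda>t. F (q(v := t))) has_field_derivative \<delta> v) (at (q v))" "d = (\<Sum>v\<in>V. \<delta> v * X v)"
    using assms unfolding has_dir_deriv_def by auto
  then show ?thesis by (auto intro!: sum.cong simp: DERIV_imp_deriv)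
qed

section \<open>Variables and components of the map f\<close>

lemma concat_map_if: "concat (map (\<lambda>j. if P j then [f j] else []) ys) = map f (filter P ys)"
  by (induction ys) auto

lemma set_vars:
  "set (vars n ms) = {VLam} \<union> {VY i j |i j. i < n \<and> j < sum_list ms}
    \<union> {VS i j |i j. i < sum_list ms \<and> j < sum_list ms \<and> blk ms i < blk ms j}"
  unfolding vars_def by (auto simp: concat_map_if)

text \<open>Allows sums over column positions of the Jacobian to be rewritten as sums over
  variables. Each comprehension is recast as an injective map over a filtered or full product
  list.\<close>

lemma distinct_vars: "distinct (vars n ms)"
proof -
  let ?m = "sum_list ms"
  have VY: "[VY i j. j \<leftarrow> [0..<?m], i \<leftarrow> [0..<n]]
      = map (\<lambda>(j, i). VY i j) (List.product [0..<?m] [0..<n])"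
    by (simp add: product_concat_map map_concat comp_def)
  have VS: "[VS i j. i \<leftarrow> [0..<?m], j \<leftarrow> [0..<?m], blk ms i < blk ms j]
      = map (\<lambda>(i, j). VS i j) (filter (\<lambda>(i, j). blk ms i < blk ms j) (List.product [0..<?m] [0..<?m]))"
    by (simp add: product_concat_map map_concat filter_concat comp_def concat_map_if filter_map)
  have "distinct (map (\<lambda>(j, i). VY i j) (List.product [0..<?m] [0..<n]))"
    by (auto simp: distinct_map distinct_product intro!: inj_onI)
  moreover have "distinct (map (\<lambda>(i, j). VS i j)
      (filter (\<lambda>(i, j). blk ms i < blk ms j) (List.product [0..<?m] [0..<?m])))"
    by (auto simp: distinct_map distinct_product intro!: inj_onI)
  ultimately show ?thesis unfolding vars_def VY VS by auto
qed

text \<open>A point of the domain of \<open>fmap\<close> is represented by the values of its coordinates;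
  outside the matrix dimensions, \<open>mat_upd\<close> has no effect and the valuation is arbitrary.\<close>
definition represents :: "nat \<Rightarrow> nat \<Rightarrow> (var \<Rightarrow> complex) \<Rightarrow> complex \<times> complex mat \<times> complex mat \<Rightarrow> bool" where
  "represents n m q p \<longleftrightarrow> (case p of (l, Y, S) \<Rightarrow>
     Y \<in> carrier_mat n m \<and> S \<in> carrier_mat m m \<and> q VLam = l \<and>
     (\<forall>i < n. \<forall>j < m. q (VY i j) = Y $$ (i, j)) \<and> (\<forall>i < m. \<forall>j < m. q (VS i j) = S $$ (i, j)))"

lemma represents_var_val:
  "Y \<in> carrier_mat n m \<Longrightarrow> S \<in> carrier_mat m m \<Longrightarrow> represents n m (var_val (l, Y, S)) (l, Y, S)"
  by (simp add: represents_def)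

lemma represents_var_upd:
  "represents n m q (l, Y, S) \<Longrightarrow> represents n m (q(v := t)) (var_upd (l, Y, S) v t)"
  by (cases v) (auto simp: represents_def mat_upd_def)

definition residual_component :: "complex mat \<Rightarrow> nat \<Rightarrow> nat \<Rightarrow> nat \<Rightarrow> nat \<Rightarrow> (var \<Rightarrow> complex) \<Rightarrow> complex" where
  "residual_component A n m i j = (\<lambda>q. (\<Sum>k<n. A $$ (i, k) * q (VY k j)) - q VLam * q (VY i j)
     - (\<Sum>k<m. q (VY i k) * q (VS k j)))"

definition herm_component :: "nat \<Rightarrow> complex vec \<Rightarrow> nat \<Rightarrow> complex \<Rightarrow> (var \<Rightarrow> complex) \<Rightarrow> complex" where
  "herm_component n x i a = (\<lambda>q. (\<Sum>k<n. cnj (x $ k) * q (VY k i)) - a)"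

text \<open>The components of \<open>fmap\<close> in the same order, as functions of a valuation of
  the variables, so that a partial derivative is a derivative along
  \<open>q(v := t)\<close>.\<close>

definition fmap_components :: "complex mat \<Rightarrow> nat \<Rightarrow> nat list \<Rightarrow> (nat \<Rightarrow> complex vec) \<Rightarrow> (nat \<Rightarrow> complex vec)
    \<Rightarrow> ((var \<Rightarrow> complex) \<Rightarrow> complex) list" where
  "fmap_components A n ms b c = (let m = sum_list ms in
     [residual_component A n m i j. j \<leftarrow> [0..<m], i \<leftarrow> [0..<n]]
     @ [herm_component n (c j) i (if i = j then 1 else 0). i \<leftarrow> [0..<m], j \<leftarrow> [0..<Suc i]]
     @ [herm_component n (b j) i 0. (i, j) \<leftarrow> Phi_list ms])"

lemma fmap_components_mem:
  "i < n \<Longrightarrow> j < sum_list ms \<Longrightarrow>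
    residual_component A n (sum_list ms) i j \<in> set (fmap_components A n ms b c)"
  "i < sum_list ms \<Longrightarrow> j \<le> i \<Longrightarrow>
    herm_component n (c j) i (if i = j then 1 else 0) \<in> set (fmap_components A n ms b c)"
  "(i, j) \<in> Phi ms \<Longrightarrow> herm_component n (b j) i 0 \<in> set (fmap_components A n ms b c)"
proof -
  assume "i < n" "j < sum_list ms"
  then have "residual_component A n (sum_list ms) i j
    \<in> set [residual_component A n (sum_list ms) i j. j \<leftarrow> [0..<sum_list ms], i \<leftarrow> [0..<n]]"
    unfolding set_concat set_map by (intro UN_I[of "map (\<lambda>i. residual_component A n (sum_list ms) i j) [0..<n]"] imageI) auto
  then show "residual_component A n (sum_list ms) i j \<in> set (fmap_components A n ms b c)"
    by (simp only: fmap_components_def Let_def set_append Un_iff simp_thms)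
next
  assume "i < sum_list ms" "j \<le> i"
  then have "herm_component n (c j) i (if i = j then 1 else 0)
    \<in> set [herm_component n (c j) i (if i = j then 1 else 0). i \<leftarrow> [0..<sum_list ms], j \<leftarrow> [0..<Suc i]]"
    unfolding set_concat set_map
    by (intro UN_I[of "map (\<lambda>j. herm_component n (c j) i (if i = j then 1 else 0)) [0..<Suc i]"] imageI)
      (auto simp del: upt_Suc)
  then show "herm_component n (c j) i (if i = j then 1 else 0) \<in> set (fmap_components A n ms b c)"
    by (simp only: fmap_components_def Let_def set_append Un_iff simp_thms)
next
  show "(i, j) \<in> Phi ms \<Longrightarrow> herm_component n (b j) i 0 \<in> set (fmap_components A n ms b c)"
    by (force simp: fmap_components_def Let_def Phi_def)
qed

lemma residual_index:
  fixes A Y :: "complex mat"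
  assumes A: "A \<in> carrier_mat n n" and Y: "Y \<in> carrier_mat n m" and ij: "i < n" "j < m"
  shows "((A - l \<cdot>\<^sub>m 1\<^sub>m n) * Y) $$ (i, j) = (\<Sum>k<n. A $$ (i, k) * Y $$ (k, j)) - l * Y $$ (i, j)"
proof -
  have "((A - l \<cdot>\<^sub>m 1\<^sub>m n) * Y) $$ (i, j) = (\<Sum>k<n. (A $$ (i, k) - (if i = k then l else 0)) * Y $$ (k, j))"
    using ij A Y by (auto simp: scalar_prod_def atLeast0LessThan intro!: sum.cong)
  also have "\<dots> = (\<Sum>k<n. A $$ (i, k) * Y $$ (k, j)) - (\<Sum>k<n. if k = i then l * Y $$ (k, j) else 0)"
    unfolding sum_subtractf[symmetric] by (intro sum.cong) (auto simp: algebra_simps)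
  also have "\<dots> = (\<Sum>k<n. A $$ (i, k) * Y $$ (k, j)) - l * Y $$ (i, j)"
    using ij by simp
  finally show ?thesis .
qed

lemma fmap_eq_components:
  assumes A: "A \<in> carrier_mat n n" and b: "\<And>j. b j \<in> carrier_vec n" and c: "\<And>j. c j \<in> carrier_vec n"
    and q: "represents n (sum_list ms) q p"
  shows "fmap A n ms b c p = map (\<lambda>F. F q) (fmap_components A n ms b c)"
proof -
  let ?m = "sum_list ms"
  obtain l Y S where p: "p = (l, Y, S)" by (cases p) auto
  have Y: "Y \<in> carrier_mat n ?m" and S: "S \<in> carrier_mat ?m ?m" and ql: "q VLam = l"
    and qY: "\<And>i j. i < n \<Longrightarrow> j < ?m \<Longrightarrow> q (VY i j) = Y $$ (i, j)"
    and qS: "\<And>i j. i < ?m \<Longrightarrow> j < ?m \<Longrightarrow> q (VS i j) = S $$ (i, j)"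
    using q unfolding p represents_def by auto
  have R: "((A - l \<cdot>\<^sub>m 1\<^sub>m n) * Y - Y * S) $$ (i, j) = residual_component A n ?m i j q"
    if ij: "i < n" "j < ?m" for i j
  proof -
    have "(Y * S) $$ (i, j) = (\<Sum>k<?m. Y $$ (i, k) * S $$ (k, j))"
      using ij Y S by (simp add: scalar_prod_def atLeast0LessThan)
    moreover have "((A - l \<cdot>\<^sub>m 1\<^sub>m n) * Y - Y * S) $$ (i, j) = ((A - l \<cdot>\<^sub>m 1\<^sub>m n) * Y) $$ (i, j) - (Y * S) $$ (i, j)"
      using ij A Y S by (intro index_minus_mat) auto
    ultimately show ?thesis
      using ij residual_index[OF A Y ij, of l] by (simp add: residual_component_def ql qY qS)
  qed
  have H: "herm x (col Y i) - a = herm_component n x i a q" if "x \<in> carrier_vec n" "i < ?m" for x i a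
    using that Y by (simp add: herm_def qY herm_component_def)
  have Phi: "i < ?m" if "(i, j) \<in> set (Phi_list ms)" for i j
    using that by (auto simp: Phi_list_def)
  show ?thesis
    unfolding p fmap_def fmap_components_def Let_def prod.case map_append map_concat map_map comp_def
    using Phi by (intro arg_cong2[where f = append] arg_cong[where f = concat] map_cong refl)
      (auto simp: R H[OF c] H[OF b, where a = 0, simplified])
qed

text \<open>The Jacobian row belonging to \<open>F\<close>, multiplied by \<open>x\<close>, is the
  directional derivative of \<open>F\<close> along \<open>X\<close>, where \<open>X\<close> is
  \<open>x\<close> indexed by variables instead of positions.\<close>

lemma jacobian_kernel:
  assumes A: "A \<in> carrier_mat n n" and b: "\<And>j. b j \<in> carrier_vec n" and c: "\<And>j. c j \<in> carrier_vec n"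
    and Y: "Y \<in> carrier_mat n (sum_list ms)" and S: "S \<in> carrier_mat (sum_list ms) (sum_list ms)"
    and J: "J = jacobian (fmap A n ms b c) (l, Y, S) (vars n ms)"
    and x: "x \<in> carrier_vec (dim_col J)" and 0: "J *\<^sub>v x = 0\<^sub>v (dim_row J)"
    and X: "\<And>k. k < length (vars n ms) \<Longrightarrow> X (vars n ms ! k) = x $ k"
    and F: "F \<in> set (fmap_components A n ms b c)"
    and d: "has_dir_deriv (set (vars n ms)) (var_val (l, Y, S)) X F d"
  shows "d = 0"
proof -
  let ?p = "(l, Y, S)" and ?Fs = "fmap_components A n ms b c" and ?vs = "vars n ms"
  let ?q = "var_val ?p"
  have rep: "represents n (sum_list ms) ?q ?p" by (rule represents_var_val[OF Y S])
  have f0: "fmap A n ms b c ?p = map (\<lambda>F. F ?q) ?Fs"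
    by (rule fmap_eq_components[OF A b c rep])
  \<comment> \<open>Changing one variable of the point changes one value of the valuation, so the
    same components describe all perturbed points.\<close>
  have f: "fmap A n ms b c (var_upd ?p v t) = map (\<lambda>F. F (?q(v := t))) ?Fs" for v t
    by (rule fmap_eq_components[OF A b c represents_var_upd[OF rep]])
  from F obtain r where r: "r < length ?Fs" "?Fs ! r = F" by (auto simp: in_set_conv_nth)
  have dims: "dim_row J = length ?Fs" "dim_col J = length ?vs"
    unfolding J jacobian_def by (simp_all add: f0)
  have entry: "J $$ (r, k) = deriv (\<lambda>t. F (?q(?vs ! k := t))) (?q (?vs ! k))" if "k < length ?vs" for k
    using r that unfolding J jacobian_def by (simp add: f0 f del: var_upd.simps)
  have "0 = (J *\<^sub>v x) $ r" using 0 dims r by simp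
  also have "\<dots> = (\<Sum>k<length ?vs. J $$ (r, k) * x $ k)"
    using x dims r by (simp add: scalar_prod_def atLeast0LessThan)
  also have "\<dots> = (\<Sum>k<length ?vs. deriv (\<lambda>t. F (?q(?vs ! k := t))) (?q (?vs ! k)) * X (?vs ! k))"
    by (intro sum.cong) (auto simp: entry X)
  also have "\<dots> = (\<Sum>v\<in>set ?vs. deriv (\<lambda>t. F (?q(v := t))) (?q v) * X v)"
    by (rule sum.reindex_bij_betw[OF bij_betw_nth[OF distinct_vars refl refl]])
  also have "\<dots> = d" by (rule has_dir_deriv_imp_sum_deriv[OF d])
  finally show ?thesis ..
qed

section \<open>Genericity and the Weyr characteristic\<close>

text \<open>The Weyr numbers telescope to the kernel dimensions. The Jordan form expresses these as
  sums of \<open>min k s\<close> over block sizes \<open>s\<close>, and for large \<open>k\<close>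
  this is the algebraic multiplicity.\<close>

lemma dim_gen_eigenspace_eq_mu:
  fixes A :: "complex mat"
  assumes A: "A \<in> carrier_mat n n"
    and weyr: "\<forall>j. 1 \<le> j \<and> j \<le> length ms \<longrightarrow> weyr A lam j = ms ! (j - 1)"
      "\<forall>j. length ms < j \<longrightarrow> weyr A lam j = 0"
  shows "dim_gen_eigenspace A lam l = mu ms l"
    and "sum_list ms = Polynomial.order lam (char_poly A)"
proof -
  obtain as where "char_poly A = (\<Prod>a\<leftarrow>as. [:- a, 1:])" using char_poly_factorized[OF A] by auto
  from jordan_nf_exists[OF A this] obtain n_as where jnf: "jordan_nf A n_as" by auto
  define sizes where "sizes = map fst [(n, e)\<leftarrow>n_as . e = lam]"
  let ?D = "dim_gen_eigenspace A lam"
  have D: "?D k = (\<Sum>s\<leftarrow>sizes. min k s)" for k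
    using dim_gen_eigenspace[OF jnf] by (simp add: sizes_def)
  \<comment> \<open>Monotonicity ensures that the truncated subtraction in \<open>weyr\<close> is a
    true difference.\<close>
  have mono: "?D k \<le> ?D (Suc k)" for k
    unfolding D by (intro sum_list_mono) auto
  have D_eq: "?D l = mu ms l" for l
  proof (induction l)
    case 0
    have "(\<Sum>s\<leftarrow>sizes. min 0 s) = 0" by (induction sizes) auto
    then show ?case by (simp add: D)
  next
    case (Suc l)
    have step: "?D (Suc l) = ?D l + weyr A lam (Suc l)"
      using mono[of l] by (simp add: weyr_def)
    show ?case
    proof (cases "l < length ms")
      case True
      then show ?thesis using step Suc weyr(1) by (simp add: take_Suc_conv_app_nth)
    next
      case False
      then show ?thesis using step Suc weyr(2) by simp
    qed
  qed
  then show "?D l = mu ms l" by blast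
  have "Polynomial.order lam (char_poly A) = sum_list sizes"
    using jordan_nf_order[OF jnf] by (simp add: sizes_def case_prod_unfold)
  \<comment> \<open>This power is at least every Jordan block size and also at least
    \<open>length ms\<close>, so both formulas for the dimension have stabilized.\<close>
  also have "\<dots> = ?D (length ms + sum_list sizes)"
  proof -
    have "min (length ms + sum_list sizes) s = s" if "s \<in> set sizes" for s
      using member_le_sum_list[OF that] by simp
    then have "map (min (length ms + sum_list sizes)) sizes = sizes" by (simp add: map_idI)
    then show ?thesis by (simp add: D)
  qed
  also have "\<dots> = sum_list ms" by (simp add: D_eq)
  finally show "sum_list ms = Polynomial.order lam (char_poly A)" ..
qed

section \<open>Full column rank at the solution\<close>

context generic_flag
begin

lemma is_sol_iff_solution:
  assumes "N = A - lam \<cdot>\<^sub>m 1\<^sub>m n"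
  shows "is_sol A lam n m ms b c YS \<longleftrightarrow> solution (fst YS) (snd YS)"
proof -
  have "constrained (\<lambda>_. 1) Y \<longleftrightarrow>
    (\<forall>i < m. \<forall>j \<le> i. herm (c j) (col Y i) = (if j = i then 1 else 0)) \<and>
    (\<forall>(i, j) \<in> Phi ms. herm (b j) (col Y i) = 0)" for Y
    unfolding constrained_def constraint_indices_iff by (intro all_cong1 imp_cong refl) auto
  then show ?thesis unfolding is_sol_def solution_def Let_def assms[symmetric] by blast
qed

lemma full_col_rank_jacobian:
  assumes A: "A \<in> carrier_mat n n" and NA: "N = A - lam \<cdot>\<^sub>m 1\<^sub>m n"
    and sol: "solution Y S" and m: "0 < m"
  shows "full_col_rank (jacobian (fmap A n ms b c) (lam, Y, S) (vars n ms))"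
proof -
  let ?q = "var_val (lam, Y, S)" and ?vs = "vars n ms"
  define J where "J = jacobian (fmap A n ms b c) (lam, Y, S) ?vs"
  have Y: "Y \<in> carrier_mat n m" and S: "S \<in> carrier_mat m m"
    using sol staircaseD(1) by (auto simp: solution_def)
  have dimJ: "dim_col J = length ?vs" by (simp add: J_def jacobian_def)
  have "x = 0\<^sub>v (dim_col J)" if x: "x \<in> carrier_vec (dim_col J)" and Jx: "J *\<^sub>v x = 0\<^sub>v (dim_row J)" for x
  proof -
    define X where "X v = x $ the_inv_into {..<length ?vs} (\<lambda>k. ?vs ! k) v" for v
    have X: "X (?vs ! k) = x $ k" if "k < length ?vs" for k
      using that distinct_vars[of n ms] by (simp add: X_def the_inv_into_f_f inj_on_nth)
    \<comment> \<open>Extension by zero beyond the free variables; it gives \<open>T\<close> below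
      its staircase shape.\<close>
    define D where "D v = (if v \<in> set ?vs then X v else 0)" for v
    have zero: "d = 0" if "F \<in> set (fmap_components A n ms b c)" "has_dir_deriv (set ?vs) ?q X F d" for F d
      by (rule jacobian_kernel[OF A b c Y S J_def x Jx X that])
    note coord = has_dir_deriv_coord[OF finite_set, of ?vs ?q X, folded D_def]
    define Z where "Z = mat n m (\<lambda>(i, j). D (VY i j))"
    define T where "T = mat m m (\<lambda>(i, j). D (VS i j))"
    have Z: "Z \<in> carrier_mat n m" and T: "T \<in> carrier_mat m m" by (simp_all add: Z_def T_def)
    have stT: "staircase ms T"
      using T by (auto simp: staircase_def T_def D_def set_vars)
    have eq: "N * Z = Z * S + (D VLam \<cdot>\<^sub>m Y + Y * T)"
    proof (rule eq_matI)
      fix i j assume "i < dim_row (Z * S + (D VLam \<cdot>\<^sub>m Y + Y * T))" "j < dim_col (Z * S + (D VLam \<cdot>\<^sub>m Y + Y * T))"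
      then have ij: "i < n" "j < m" using Y T by auto
      \<comment> \<open>The product rule turns the vanishing of this derivative into entry
        \<open>(i, j)\<close> of the linearized equation.\<close>
      have "has_dir_deriv (set ?vs) ?q X (residual_component A n m i j)
        ((\<Sum>k<n. A $$ (i, k) * D (VY k j)) - (D VLam * ?q (VY i j) + ?q VLam * D (VY i j))
          - (\<Sum>k<m. D (VY i k) * ?q (VS k j) + ?q (VY i k) * D (VS k j)))"
        unfolding residual_component_def
        by (intro has_dir_deriv_diff has_dir_deriv_sum has_dir_deriv_cmult has_dir_deriv_mult coord)
      from zero[OF fmap_components_mem(1)[OF ij] this]
      have "(\<Sum>k<n. A $$ (i, k) * D (VY k j)) - lam * D (VY i j)
          = (\<Sum>k<m. D (VY i k) * S $$ (k, j)) + (D VLam * Y $$ (i, j) + (\<Sum>k<m. Y $$ (i, k) * D (VS k j)))"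
        by (simp add: sum.distrib algebra_simps)
      moreover have "(N * Z) $$ (i, j) = (\<Sum>k<n. A $$ (i, k) * D (VY k j)) - lam * D (VY i j)"
        using residual_index[OF A Z ij, of lam] ij by (simp add: NA Z_def)
      moreover have "(Z * S) $$ (i, j) = (\<Sum>k<m. D (VY i k) * S $$ (k, j))"
        using ij S by (simp add: scalar_prod_def atLeast0LessThan Z_def)
      moreover have "(Y * T) $$ (i, j) = (\<Sum>k<m. Y $$ (i, k) * D (VS k j))"
        using ij Y by (simp add: scalar_prod_def atLeast0LessThan T_def)
      moreover have "(Z * S + (D VLam \<cdot>\<^sub>m Y + Y * T)) $$ (i, j)
          = (Z * S) $$ (i, j) + (D VLam * Y $$ (i, j) + (Y * T) $$ (i, j))"
        using ij Y Z S T by (simp del: index_mult_mat(1))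
      ultimately show "(N * Z) $$ (i, j) = (Z * S + (D VLam \<cdot>\<^sub>m Y + Y * T)) $$ (i, j)" by metis
    qed (use N Y Z S T in auto)
    \<comment> \<open>The normalization components are affine in \<open>Y\<close>, so
      differentiating drops the constant and leaves homogeneous conditions on
      \<open>Z\<close>.\<close>
    have herm0: "herm y (col Z i) = 0"
      if "herm_component n y i a \<in> set (fmap_components A n ms b c)" "y \<in> carrier_vec n" "i < m" for y i a
    proof -
      have "has_dir_deriv (set ?vs) ?q X (herm_component n y i a) ((\<Sum>k<n. cnj (y $ k) * D (VY k i)) - 0)"
        unfolding herm_component_def
        by (intro has_dir_deriv_diff has_dir_deriv_sum has_dir_deriv_cmult has_dir_deriv_const coord)
      from zero[OF that(1) this] show ?thesis using that by (simp add: herm_def Z_def)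
    qed
    have "constrained (\<lambda>_. 0) Z \<longleftrightarrow> (\<forall>i < m. \<forall>j \<le> i. herm (c j) (col Z i) = 0) \<and>
        (\<forall>(i, j) \<in> Phi ms. herm (b j) (col Z i) = 0)"
      unfolding constrained_def constraint_indices_iff by (intro all_cong1 imp_cong refl) auto
    moreover have "herm (c j) (col Z i) = 0" if "i < m" "j \<le> i" for i j
      by (rule herm0[OF fmap_components_mem(2)[OF that] c that(1)])
    moreover have "herm (b j) (col Z i) = 0" if "(i, j) \<in> Phi ms" for i j
      using herm0[OF fmap_components_mem(3)[OF that] b] that Phi_iff by blast
    ultimately have con: "constrained (\<lambda>_. 0) Z" by blast
    have lin: "D VLam = 0" "Z = 0\<^sub>m n m" "T = 0\<^sub>m m m"
      using linearization_injective[OF sol Z stT eq con m] by auto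
    have "D v = 0" if "v \<in> set ?vs" for v
    proof (cases v)
      case VLam
      then show ?thesis using lin by simp
    next
      case (VY i j)
      then have ij: "i < n" "j < m" using that by (auto simp: set_vars)
      then have "Z $$ (i, j) = D v" using VY by (simp add: Z_def)
      then show ?thesis using lin(2) ij by simp
    next
      case (VS i j)
      then have ij: "i < m" "j < m" using that by (auto simp: set_vars)
      then have "T $$ (i, j) = D v" using VS by (simp add: T_def)
      then show ?thesis using lin(3) ij by simp
    qed
    then have "x $ k = 0" if "k < length ?vs" for k
      using X[OF that] that by (metis D_def nth_mem)
    then show ?thesis using x dimJ by (intro eq_vecI) auto
  qed
  then show ?thesis
    unfolding full_col_rank_def J_def[symmetric] by (intro rank_eq_dim_colI) auto
qed

end

section \<open>Almost every choice of b and c is in general position\<close>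

context staircase_flag
begin

text \<open>In the basis \<open>B i\<close> the functionals for column \<open>i\<close> form a
  square matrix. Its nonzero determinant gives both triviality of the homogeneous system and
  solvability for a unit vector.\<close>

lemma generic_flagI:
  assumes b: "\<And>j. b j \<in> carrier_vec n" and c: "\<And>j. c j \<in> carrier_vec n"
    and B: "\<And>i. i < m \<Longrightarrow> B i \<in> carrier_mat n (mu ms (Suc (blk ms i)))"
    and range: "\<And>i a. i < m \<Longrightarrow> a \<in> carrier_vec (mu ms (Suc (blk ms i))) \<Longrightarrow> B i *\<^sub>v a \<in> K (Suc (blk ms i))"
    and surj: "\<And>i v. i < m \<Longrightarrow> v \<in> K (Suc (blk ms i)) \<Longrightarrow>
      \<exists>a \<in> carrier_vec (mu ms (Suc (blk ms i))). v = B i *\<^sub>v a"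
    and det: "\<And>i. i < m \<Longrightarrow> det (mat (mu ms (Suc (blk ms i))) (mu ms (Suc (blk ms i)))
      (\<lambda>(r, s). herm (if r \<le> i then c r else b r) (col (B i) s))) \<noteq> 0"
  shows "generic_flag N n ms b c"
proof unfold_locales
  have inj: "a = 0\<^sub>v (mu ms (Suc (blk ms i)))"
    if "i < m" "a \<in> carrier_vec (mu ms (Suc (blk ms i)))"
      "mat (mu ms (Suc (blk ms i))) (mu ms (Suc (blk ms i)))
      (\<lambda>(r, s). herm (if r \<le> i then c r else b r) (col (B i) s)) *\<^sub>v a = 0\<^sub>v (mu ms (Suc (blk ms i)))" for i a
    using det[OF that(1)] det_0_iff_vec_prod_zero_field[OF mat_carrier] that(2,3) by blast
  have herm: "herm (if r \<le> i then c r else b r) (B i *\<^sub>v a)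
      = (mat (mu ms (Suc (blk ms i))) (mu ms (Suc (blk ms i)))
      (\<lambda>(r, s). herm (if r \<le> i then c r else b r) (col (B i) s)) *\<^sub>v a) $ r"
    if "i < m" "r < mu ms (Suc (blk ms i))" "a \<in> carrier_vec (mu ms (Suc (blk ms i)))" for i r a
  proof -
    have "(if r \<le> i then c r else b r) \<in> carrier_vec n" using b c by simp
    from herm_mult_mat_vec[OF this B[OF that(1)] that(3)] show ?thesis
      unfolding mult_mat_vec_index_sum[OF mat_carrier that(3,2)] using that(2) by simp
  qed
  fix i assume i: "i < m"
  let ?d = "mu ms (Suc (blk ms i))"
  {
    fix v assume v: "v \<in> K (Suc (blk ms i))"
      and 0: "\<And>r. r < ?d \<Longrightarrow> herm (if r \<le> i then c r else b r) v = 0"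
    obtain a where a: "a \<in> carrier_vec ?d" "v = B i *\<^sub>v a" using surj[OF i v] by blast
    have "a = 0\<^sub>v ?d"
      by (rule inj[OF i a(1)], rule eq_vecI) (use herm[OF i _ a(1)] 0 a(2) in auto)
    then show "v = 0\<^sub>v n" using a(2) mult_mat_vec_zero[OF B[OF i]] by simp
  }
  \<comment> \<open>Row \<open>i\<close> is present because \<open>i\<close> lies in its own block,
    so the right-hand side is a genuine unit vector.\<close>
  have id: "i < ?d" using less_mu_Suc_blk_iff[OF i, of i] by simp
  obtain a where a: "a \<in> carrier_vec ?d"
    "mat ?d ?d (\<lambda>(r, s). herm (if r \<le> i then c r else b r) (col (B i) s)) *\<^sub>v a = unit_vec ?d i"
    using inj_square_mat_surj[OF mat_carrier inj[OF i] unit_vec_carrier] by blast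
  show "\<exists>v \<in> K (Suc (blk ms i)). \<forall>r < ?d. herm (if r \<le> i then c r else b r) v = (if r = i then 1 else 0)"
    using herm[OF i _ a(1)] a(2) id by (intro bexI[OF _ range[OF i a(1)]]) auto
qed (use b c in auto)

text \<open>Each column excludes one null set, where its determinant vanishes, and there are
  finitely many columns.\<close>

lemma AE_generic_flag:
  "AE z in PiM ({..<2 * m} \<times> {..<n}) (\<lambda>_. lborel :: complex measure).
    generic_flag N n ms (\<lambda>j. vec n (\<lambda>k. z (j, k))) (\<lambda>j. vec n (\<lambda>k. z (m + j, k)))"
proof -
  let ?Q = "\<lambda>i B. B \<in> carrier_mat n (mu ms (Suc (blk ms i))) \<and>
    (\<forall>a \<in> carrier_vec (mu ms (Suc (blk ms i))). B *\<^sub>v a \<in> K (Suc (blk ms i))) \<and>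
    (\<forall>v \<in> K (Suc (blk ms i)). \<exists>a \<in> carrier_vec (mu ms (Suc (blk ms i))). v = B *\<^sub>v a) \<and>
    (\<forall>a \<in> carrier_vec (mu ms (Suc (blk ms i))). B *\<^sub>v a = 0\<^sub>v n \<longrightarrow> a = 0\<^sub>v (mu ms (Suc (blk ms i))))"
  have ex: "\<exists>B. ?Q i B" if "i < m" for i
    using K_basis[OF Suc_leI[OF blk_less_length[OF that]]] by (simp only: Bex_def)
  \<comment> \<open>The bases depend on \<open>N\<close> alone and are fixed before
    \<open>z\<close>, as the determinant lemma requires.\<close>
  define B where "B i = (SOME B. ?Q i B)" for i
  have "?Q i (B i)" if "i < m" for i
    unfolding B_def by (rule someI_ex[OF ex[OF that]])
  then have B: "\<And>i. i < m \<Longrightarrow> B i \<in> carrier_mat n (mu ms (Suc (blk ms i)))"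
    "\<And>i a. i < m \<Longrightarrow> a \<in> carrier_vec (mu ms (Suc (blk ms i))) \<Longrightarrow> B i *\<^sub>v a \<in> K (Suc (blk ms i))"
    "\<And>i v. i < m \<Longrightarrow> v \<in> K (Suc (blk ms i)) \<Longrightarrow> \<exists>a \<in> carrier_vec (mu ms (Suc (blk ms i))). v = B i *\<^sub>v a"
    "\<And>i a. i < m \<Longrightarrow> a \<in> carrier_vec (mu ms (Suc (blk ms i))) \<Longrightarrow> B i *\<^sub>v a = 0\<^sub>v n \<Longrightarrow>
      a = 0\<^sub>v (mu ms (Suc (blk ms i)))"
    by blast+
  \<comment> \<open>Row \<open>r\<close> takes \<open>c r\<close>, stored at \<open>m + r\<close>,
    when \<open>r \<le> i\<close>, and otherwise \<open>b r\<close>, stored at \<open>r\<close>. The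
    two ranges are disjoint because \<open>r < m\<close>.\<close>
  define \<rho> where "\<rho> i r = (if r \<le> i then m + r else r)" for i r :: nat
  let ?F = "\<lambda>i z. mat (mu ms (Suc (blk ms i))) (mu ms (Suc (blk ms i)))
      (\<lambda>(r, s). herm (vec n (\<lambda>k. z (\<rho> i r, k))) (col (B i) s))"
  have "AE z in PiM ({..<2 * m} \<times> {..<n}) (\<lambda>_. lborel :: complex measure). \<forall>i\<in>{..<m}. det (?F i z) \<noteq> 0"
  proof (intro AE_finite_allI ballI)
    fix i assume "i \<in> {..<m}"
    then have i: "i < m" by simp
    have dm: "mu ms (Suc (blk ms i)) \<le> m" by (rule mu_le_sum_list)
    show "AE z in PiM ({..<2 * m} \<times> {..<n}) (\<lambda>_. lborel :: complex measure). det (?F i z) \<noteq> 0"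
    proof (rule AE_det_herm_nonzero[OF B(1)[OF i] B(4)[OF i]])
      show "inj_on (\<rho> i) {..<mu ms (Suc (blk ms i))}"
        using dm by (auto simp: inj_on_def \<rho>_def split: if_splits)
      show "\<rho> i ` {..<mu ms (Suc (blk ms i))} \<subseteq> {..<2 * m}"
        using dm by (auto simp: \<rho>_def)
    qed auto
  qed simp
  then show ?thesis
  proof (rule AE_mp, intro AE_I2 impI)
    fix z :: "nat \<times> nat \<Rightarrow> complex"
    assume det: "\<forall>i\<in>{..<m}. det (?F i z) \<noteq> 0"
    have "vec n (\<lambda>k. z (\<rho> i r, k)) = (if r \<le> i then vec n (\<lambda>k. z (m + r, k)) else vec n (\<lambda>k. z (r, k)))" for i r
      by (simp add: \<rho>_def)
    then show "generic_flag N n ms (\<lambda>j. vec n (\<lambda>k. z (j, k))) (\<lambda>j. vec n (\<lambda>k. z (m + j, k)))"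
      using det by (intro generic_flagI[OF _ _ B(1-3)]) auto
  qed
qed

end

theorem theorem2:
  fixes A :: "complex mat" and lam :: complex and n m :: nat and ms :: "nat list"
  assumes "A \<in> carrier_mat n n"
    and "eigenvalue A lam"
    and "m = Polynomial.order lam (char_poly A)"
    and "\<forall>j. 1 \<le> j \<and> j \<le> length ms \<longrightarrow> weyr A lam j = ms ! (j - 1)"
    and "\<forall>j. length ms < j \<longrightarrow> weyr A lam j = 0"
    and "\<forall>x \<in> set ms. 0 < x"
  shows "AE z in PiM ({..<2 * m} \<times> {..<n}) (\<lambda>_. (lborel :: complex measure)).
     (let b = (\<lambda>j. vec n (\<lambda>k. z (j, k)));
          c = (\<lambda>j. vec n (\<lambda>k. z (m + j, k))) in
       (\<exists>!YS. is_sol A lam n m ms b c YS) \<and>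
       (\<forall>YS. is_sol A lam n m ms b c YS \<longrightarrow>
          full_col_rank (jacobian (fmap A n ms b c) (lam, fst YS, snd YS) (vars n ms))))"
proof -
  note A = assms(1)
  note dim = dim_gen_eigenspace_eq_mu[OF A assms(4,5)]
  have m: "m = sum_list ms" using dim(2) assms(3) by simp
  \<comment> \<open>An eigenvalue is a root of the characteristic polynomial; positivity is what the
    trace argument divides by.\<close>
  have "0 < m"
  proof -
    have "char_poly A \<noteq> 0" using degree_monic_char_poly[OF A] by auto
    moreover have "poly (char_poly A) lam = 0" using assms(2) eigenvalue_root_char_poly[OF A] by simp
    ultimately show ?thesis using assms(3) order_root by blast
  qed
  \<comment> \<open>\<open>char_matrix A lam\<close> plays the role of \<open>N\<close>, since
    \<open>dim_gen_eigenspace\<close> is the kernel dimension of its powers.\<close>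
  have char: "char_matrix A lam = A - lam \<cdot>\<^sub>m 1\<^sub>m n"
    using A by (intro eq_matI) (auto simp: char_matrix_def)
  interpret staircase_flag "char_matrix A lam" n ms
  proof
    show "char_matrix A lam \<in> carrier_mat n n" using A by simp
    show "kernel_dim (char_matrix A lam ^\<^sub>m l) = mu ms l" for l
      using dim(1)[of l] by (simp add: dim_gen_eigenspace_def)
    show "kernel_dim (char_matrix A lam ^\<^sub>m Suc (length ms)) = sum_list ms"
      using dim(1)[of "Suc (length ms)"] by (simp add: dim_gen_eigenspace_def)
  qed
  show ?thesis
    unfolding m
  proof (rule AE_mp[OF AE_generic_flag], intro AE_I2 impI)
    fix z :: "nat \<times> nat \<Rightarrow> complex"
    let ?b = "\<lambda>j. vec n (\<lambda>k. z (j, k))" and ?c = "\<lambda>j. vec n (\<lambda>k. z (sum_list ms + j, k))"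
    assume "generic_flag (char_matrix A lam) n ms ?b ?c"
    then interpret generic_flag "char_matrix A lam" n ms ?b ?c .
    note iff = is_sol_iff_solution[OF char]
    have "\<exists>!YS. is_sol A lam n (sum_list ms) ms ?b ?c YS"
      unfolding iff using solution_exists solution_unique by (metis fst_conv prod_eq_iff snd_conv)
    moreover have "full_col_rank (jacobian (fmap A n ms ?b ?c) (lam, fst YS, snd YS) (vars n ms))"
      if "is_sol A lam n (sum_list ms) ms ?b ?c YS" for YS
      using full_col_rank_jacobian[OF A char] that \<open>0 < m\<close> unfolding iff m by blast
    ultimately show "let b = ?b; c = ?c in (\<exists>!YS. is_sol A lam n (sum_list ms) ms b c YS) \<and>
       (\<forall>YS. is_sol A lam n (sum_list ms) ms b c YS \<longrightarrow>
          full_col_rank (jacobian (fmap A n ms b c) (lam, fst YS, snd YS) (vars n ms)))"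
      unfolding Let_def by blast
  qed
qed

end
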